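(* Let $(\mu_\alpha,c_\alpha)$ be a net where each $\mu_\alpha$ is a Borel probability measure on $\mathbb{R}$, $c_\alpha>0$ and $(c_\alpha)$ converges to $0$, and let $\overline{L}$ be the associated generalized log-moment generating function. Let $\lambda\ge 0$. If $\overline{L}_r'(\lambda^+)>-\infty$, assume that $\overline{L}'_r(\lambda^+)$ is a limit point of the set $\{\overline{L}'_r(t):t>\lambda\}$; if $\overline{L}_r'(\lambda^+)=-\infty$, assume that $\lambda=0$ and $\overline{L}(\lambda)=\overline{L}(\lambda^+)$. Then for each net $(x_\alpha,y_\alpha)$ in $[-\infty,+\infty]^2$ (indexed by the same directed set) such that $(x_\alpha)$ converges to $\overline{L}_r'(\lambda^+)$ and $\liminf_\alpha y_\alpha>\overline{L}_r'(\lambda^+)$, we have $$\limsup_\alpha c_\alpha\log\mu_\alpha([x_\alpha,y_\alpha])=\limsup_\alpha c_\alpha\log\mu_\alpha(]x_\alpha,y_\alpha[)=\overline{L}(\lambda^+)-\lambda\,\overline{L}_r'(\lambda^+),$$ and this common value equals $$\begin{cases}-\overline{L}^*(\overline{L}_r'(\lambda^+))=\inf_{t>0}\{\overline{L}(t)-t\,\overline{L}_r'(\lambda^+)\} & \text{if } \overline{L}_r'(\lambda^+)\neq-\infty,\\[2pt] -\lim_\alpha \overline{L}^*(x_\alpha)=0 & \text{if } \overline{L}_r'(\lambda^+)=-\infty.\end{cases}$$ Furthermore, put $\tilde{\lambda}=\sup\{t>\lambda:\overline{L}_{\mid ]\lambda,t]}\text{ is affine}\}$. If there is a sequence $(t_i)$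 in $]\tilde{\lambda},+\infty[$ converging to $\tilde{\lambda}$ such that $L(t_i)$ exists for every $i$, then the upper limits $\limsup_\alpha c_\alpha\log\mu_\alpha([x_\alpha,y_\alpha])$ and $\limsup_\alpha c_\alpha\log\mu_\alpha(]x_\alpha,y_\alpha[)$ are limits.
   Context: For $t\in\mathbb{R}$, $\overline{L}(t)=\limsup_\alpha c_\alpha\log\int_{\mathbb{R}}e^{c_\alpha^{-1}tx}\,\mu_\alpha(dx)\in[-\infty,+\infty]$; it is a convex function with $\overline{L}(0)=0$. "$L(t)$ exists" means that this upper limit is a limit. $\overline{L}^*(x)=\sup_{t\in\mathbb{R}}\{tx-\overline{L}(t)\}$ is the Legendre-Fenchel transform. For $t\ge 0$, $\overline{L}'_r(t)$ is the right derivative of $\overline{L}$ at $t$, where one puts $\overline{L}'_r(t)=+\infty$ if $\overline{L}(s)=+\infty$ for all $s>t$, and $\overline{L}'_r(t)=-\infty$ if $\overline{L}(s)=-\infty$ for some $s>t$. For $\lambda\ge0$, $\overline{L}'_r(\lambda^+)=\lim_{t\to\lambda,\,t>\lambda}\overline{L}'_r(t)$ and $\overline{L}(\lambda^+)=\lim_{t\to\lambda,\,t>\lambda}\overline{L}(t)$ in $[-\infty,+\infty]$. A limit point of a set $S$ is a point every neighbourhood of which contains a point of $S$ different from it. Conventions: $]a,b[$ denotes the open interval, $]a,b]$ the half-open interval, etc.; $\log 0=-\infty$; each $\mu_\alpha$ is regarded as a Borel measure on $[-\infty,+\infty]$, so that intervals may have infinite endpoints; when $\overline{L}'_r(\lambda^+)=-\infty$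 (so $\lambda=0$), $0\cdot\overline{L}'_r(\lambda^+)=0$; in that case $\overline{L}^*$ is extended to $-\infty$ by continuity, by putting $\overline{L}^*(-\infty)=-\overline{L}(0^+)$. In the definition of $\tilde\lambda$, the supremum is taken to be $\lambda$ when the set is empty. *)

theory Defs
  imports "HOL-Probability.Probability"
begin

definition directed_set :: "'i set \<Rightarrow> ('i \<Rightarrow> 'i \<Rightarrow> bool) \<Rightarrow> bool" where
  "directed_set D le \<longleftrightarrow> D \<noteq> {}
     \<and> (\<forall>i\<in>D. le i i)
     \<and> (\<forall>i\<in>D. \<forall>j\<in>D. \<forall>k\<in>D. le i j \<longrightarrow> le j k \<longrightarrow> le i k)
     \<and> (\<forall>i\<in>D. \<forall>j\<in>D. \<exists>k\<in>D. le i k \<and> le j k)"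

text \<open>Limits, upper limits and lower limits of a net indexed by a directed set are taken along
  the filter generated by its tails.\<close>

definition tails :: "'i set \<Rightarrow> ('i \<Rightarrow> 'i \<Rightarrow> bool) \<Rightarrow> 'i filter" where
  "tails D le = (INF i\<in>D. principal {j\<in>D. le i j})"

definition elog :: "ennreal \<Rightarrow> ereal" where
  "elog p = (if p = 0 then -\<infinity> else if p = \<infinity> then \<infinity> else ereal (ln (enn2real p)))"

definition scaled_lmgf :: "('i \<Rightarrow> real measure) \<Rightarrow> ('i \<Rightarrow> real) \<Rightarrow> real \<Rightarrow> 'i \<Rightarrow> ereal" where
  "scaled_lmgf \<mu> c t i = ereal (c i) * elog (\<integral>\<^sup>+ x. ennreal (exp (inverse (c i) * t * x)) \<partial>(\<mu> i))"

definition Lbar :: "'i filter \<Rightarrow> ('i \<Rightarrow> real measure) \<Rightarrow> ('i \<Rightarrow> real) \<Rightarrow> real \<Rightarrow> ereal" where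
  "Lbar F \<mu> c t = Limsup F (scaled_lmgf \<mu> c t)"

definition L_exists :: "'i filter \<Rightarrow> ('i \<Rightarrow> real measure) \<Rightarrow> ('i \<Rightarrow> real) \<Rightarrow> real \<Rightarrow> bool" where
  "L_exists F \<mu> c t \<longleftrightarrow> (scaled_lmgf \<mu> c t \<longlongrightarrow> Lbar F \<mu> c t) F"

definition right_lim :: "(real \<Rightarrow> ereal) \<Rightarrow> real \<Rightarrow> ereal" where
  "right_lim f t = Lim (at_right t) f"

text \<open>Intended for convex \<open>f\<close> with \<open>f 0 = 0\<close> and for \<open>t \<ge> 0\<close>. In the last case \<open>f t\<close> is then finite
  and \<open>f s < \<infinity>\<close> for \<open>s\<close> close to \<open>t\<close> on the right, so the limit of the difference quotients
  exists (it may be \<open>-\<infinity>\<close>).\<close>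

definition right_deriv :: "(real \<Rightarrow> ereal) \<Rightarrow> real \<Rightarrow> ereal" where
  "right_deriv f t =
     (if \<forall>s>t. f s = \<infinity> then \<infinity>
      else if \<exists>s>t. f s = -\<infinity> then -\<infinity>
      else Lim (at_right t) (\<lambda>s. (f s - f t) / ereal (s - t)))"

text \<open>The Legendre-Fenchel transform on the reals, with the value \<open>- f(0+)\<close> put at \<open>-\<infinity>\<close>; only the
  values at points different from \<open>\<infinity>\<close> are meaningful.\<close>

definition legendre :: "(real \<Rightarrow> ereal) \<Rightarrow> ereal \<Rightarrow> ereal" where
  "legendre f x = (if x = -\<infinity> then - right_lim f 0 else (SUP t. ereal t * x - f t))"

definition affine_fun_on :: "real set \<Rightarrow> (real \<Rightarrow> ereal) \<Rightarrow> bool" where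
  "affine_fun_on S f \<longleftrightarrow> (\<exists>a b. \<forall>s\<in>S. f s = ereal (a * s + b))"

definition affine_end :: "(real \<Rightarrow> ereal) \<Rightarrow> real \<Rightarrow> ereal" where
  "affine_end f r =
     (let A = {t. t > r \<and> affine_fun_on {r<..t} f}
      in if A = {} then ereal r else (SUP t\<in>A. ereal t))"

text \<open>\<open>c log \<mu>(J)\<close> for a Borel measure on the reals regarded as a measure on the extended reals.\<close>

definition scaled_log_meas :: "('i \<Rightarrow> real measure) \<Rightarrow> ('i \<Rightarrow> real) \<Rightarrow> ('i \<Rightarrow> ereal set) \<Rightarrow> 'i \<Rightarrow> ereal" where
  "scaled_log_meas \<mu> c J i = ereal (c i) * elog (emeasure (distr (\<mu> i) borel ereal) (J i))"

end

theory Submission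
  imports Defs
begin

text \<open>
  Write \<open>m\<close> for \<open>Lr\<close> and put \<open>g t = L t - t * m\<close> when \<open>m\<close> is real. Everything rests on the
  convexity of \<open>L\<close> (\<open>L_econvex\<close>): the right derivative is nondecreasing on the right half-line, so
  \<open>m\<close> is the infimum of its values beyond \<open>lam\<close>, \<open>g\<close> is nondecreasing there, and its right limit at
  \<open>lam\<close> is \<open>V\<close>. Chords of slope close to \<open>m\<close> just to the right of \<open>lam\<close> bound \<open>L\<close> from below on
  the left, so that \<open>V \<le> g\<close> on the whole line. This identifies \<open>V\<close> with the infimum of \<open>g\<close> and with
  the value of \<open>- legendre L\<close> at \<open>m\<close> (\<open>V_eq_INF\<close>, \<open>V_eq_legendre\<close>).

  The upper bound is the exponential Chebyshev inequality (\<open>chernoff\<close>): each \<open>t > 0\<close> bounds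
  the upper limit by \<open>g t\<close>, and the best choice gives \<open>V\<close>.

  The lower bound comes from exponential tilting at a point \<open>t\<close> slightly to the right of the end
  \<open>\<tau>\<close> of the affine piece of \<open>L\<close> that starts at \<open>lam\<close>. Beyond \<open>\<tau>\<close> the slopes of \<open>L\<close> are
  strictly larger than \<open>m\<close>, and as \<open>m\<close> is a limit point of the right derivatives they are still
  arbitrarily close to \<open>m\<close>. Hence numbers \<open>a < b\<close> enclose the slopes of \<open>L\<close> at \<open>t\<close>, with
  \<open>m < a\<close> and \<open>b\<close> below the lower limit of \<open>y\<close> (\<open>exposed_slopes\<close>). The measure with density
  proportional to \<open>exp (t * z / c)\<close> then concentrates on \<open>]a,b[\<close>, because comparison with the
  exponential moments at two points \<open>t1 < t < t2\<close> makes both tails exponentially small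
  (\<open>tilted_mass_bound\<close>). Removing the density costs at most \<open>exp (t * b / c)\<close>, which leaves
  \<open>L t - t * b\<close>, a number as close to \<open>V\<close> as desired. The estimate holds at every index of the net
  that is large enough and at which the scaled log-moment at \<open>t\<close> is close to \<open>L t\<close>. Such indices
  occur arbitrarily far out, which settles the upper limit. If \<open>L t\<close> is a limit, all indices
  far enough out are of this kind; points \<open>t\<close> with that property arbitrarily close to \<open>\<tau>\<close>
  therefore turn the upper limits into limits.

  When \<open>m = -\<infinity>\<close> the slopes of \<open>L\<close> tend to \<open>-\<infinity>\<close> at \<open>0\<close> while \<open>L\<close> tends to \<open>0\<close>. The same
  tilting works with \<open>\<tau> = 0\<close>, \<open>V = 0\<close> and a fixed negative \<open>b\<close>.
\<close>

section \<open>Convex functions with values in the extended reals\<close>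

text \<open>Supplies the existence of all the one-sided limits below: \<^const>\<open>Lim\<close> is a definite description,
so a value can be read off only after convergence is known. The set \<open>A\<close> allows both a half-line and
a short interval to the right of \<open>a\<close>.\<close>

lemma tendsto_at_right_INF:
  fixes h :: "real \<Rightarrow> ereal"
  assumes above: "\<And>t. t \<in> A \<Longrightarrow> a < t"
    and ev: "eventually (\<lambda>s. s \<in> A) (at_right a)"
    and mono: "\<And>s t. s \<in> A \<Longrightarrow> t \<in> A \<Longrightarrow> s \<le> t \<Longrightarrow> h s \<le> h t"
  shows "(h \<longlongrightarrow> (INF t\<in>A. h t)) (at_right a)"
proof (rule order_tendstoI)
  fix l assume l: "l < (INF t\<in>A. h t)"
  show "eventually (\<lambda>s. l < h s) (at_right a)"
    using ev by eventually_elim (metis INF_lower l less_le_trans)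
next
  fix u assume "(INF t\<in>A. h t) < u"
  then obtain t where t: "t \<in> A" "h t < u" by (auto simp: INF_less_iff)
  have "eventually (\<lambda>s. s < t) (at_right a)"
    using above[OF t(1)] by (auto simp: eventually_at_right)
  with ev show "eventually (\<lambda>s. h s < u) (at_right a)"
    by eventually_elim (meson t mono less_imp_le le_less_trans)
qed

text \<open>Real upper bounds \<open>P\<close> and \<open>Q\<close> stand for the values at the end points, so that \<open>\<infinity> - \<infinity>\<close> never
occurs; an end point with value \<open>\<infinity>\<close> gives no condition, and one with value \<open>-\<infinity>\<close> admits every
real \<open>P\<close>.\<close>

definition econvex :: "(real \<Rightarrow> ereal) \<Rightarrow> bool" where
  "econvex f \<longleftrightarrow> (\<forall>t s w P Q. t < s \<longrightarrow> s < w \<longrightarrow> f t \<le> ereal P \<longrightarrow> f w \<le> ereal Q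
     \<longrightarrow> f s \<le> ereal (((w - s) * P + (s - t) * Q) / (w - t)))"

locale convex_from_zero =
  fixes f :: "real \<Rightarrow> ereal"
  assumes conv: "econvex f" and zero: "f 0 = 0"
begin

lemma convD:
  "t < s \<Longrightarrow> s < w \<Longrightarrow> f t \<le> ereal P \<Longrightarrow> f w \<le> ereal Q
    \<Longrightarrow> f s \<le> ereal (((w - s) * P + (s - t) * Q) / (w - t))"
  using conv unfolding econvex_def by blast

lemma finite_between:
  assumes "t < s" "s < w" "f t < \<infinity>" "f w < \<infinity>"
  shows "f s < \<infinity>"
proof -
  obtain P where P: "f t < ereal P" using assms(3) ereal_dense2 by blast
  obtain Q where Q: "f w < ereal Q" using assms(4) ereal_dense2 by blast
  have "f s \<le> ereal (((w - s) * P + (s - t) * Q) / (w - t))"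
    using P Q by (intro convD[OF assms(1,2)]) auto
  then show ?thesis by auto
qed

text \<open>A chord of a convex function, prolonged beyond an end point, lies below the function. This and its mirror
image \<open>right_support\<close> also exclude the value \<open>-\<infinity>\<close> outside the chord.\<close>

lemma left_support:
  assumes "t < s" "s < w" "f s = ereal v" "f w = ereal q" "q - v \<le> k * (w - s)"
  shows "ereal (v - k * (s - t)) \<le> f t"
proof (rule ccontr)
  assume "\<not> ereal (v - k * (s - t)) \<le> f t"
  then obtain P where P: "f t < ereal P" "ereal P < ereal (v - k * (s - t))"
    using ereal_dense2 by (meson not_le)
  have "ereal v \<le> ereal (((w - s) * P + (s - t) * q) / (w - t))"
    using convD[OF assms(1,2), of P q] P assms by simp
  then have "v * (w - t) \<le> (w - s) * P + (s - t) * q"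
    using assms by (simp add: pos_le_divide_eq)
  moreover have "(w - s) * P < (w - s) * (v - k * (s - t))"
    using P assms by simp
  moreover have "(s - t) * (q - v) \<le> (s - t) * (k * (w - s))"
    using assms by (intro mult_left_mono) auto
  ultimately show False by (simp add: algebra_simps)
qed

lemma right_support:
  assumes "t < s" "s < w" "f t = ereal p" "f s = ereal v" "a * (s - t) \<le> v - p"
  shows "ereal (v + a * (w - s)) \<le> f w"
proof (rule ccontr)
  assume "\<not> ereal (v + a * (w - s)) \<le> f w"
  then obtain Q where Q: "f w < ereal Q" "ereal Q < ereal (v + a * (w - s))"
    using ereal_dense2 by (meson not_le)
  have "ereal v \<le> ereal (((w - s) * p + (s - t) * Q) / (w - t))"
    using convD[OF assms(1,2), of p Q] Q assms by simp
  then have "v * (w - t) \<le> (w - s) * p + (s - t) * Q"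
    using assms by (simp add: pos_le_divide_eq)
  moreover have "(s - t) * Q < (s - t) * (v + a * (w - s))"
    using Q assms by simp
  moreover have "(w - s) * (a * (s - t)) \<le> (w - s) * (v - p)"
    using assms by (intro mult_left_mono) auto
  ultimately show False by (simp add: algebra_simps)
qed

text \<open>The points at which \<^const>\<open>right_deriv\<close> is given by its third clause, the limit of the difference
quotients; at all other points \<open>t \<ge> 0\<close> it is \<open>\<infinity>\<close> or \<open>-\<infinity>\<close> by convention.\<close>

definition regular :: "real \<Rightarrow> bool" where
  "regular t \<longleftrightarrow> \<bar>f t\<bar> \<noteq> \<infinity> \<and> (\<exists>s>t. f s < \<infinity>) \<and> (\<forall>s>t. f s \<noteq> -\<infinity>)"

lemma regular_real: "regular t \<Longrightarrow> \<exists>p. f t = ereal p"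
  unfolding regular_def by (cases "f t") auto

text \<open>Finiteness at \<open>t\<close> itself comes from the value at \<open>0\<close>: convexity between \<open>0\<close> and \<open>s\<close> excludes \<open>\<infinity>\<close>, and
the value \<open>-\<infinity>\<close> at \<open>t\<close> would propagate to the points between \<open>t\<close> and \<open>s\<close>.\<close>

lemma regularI:
  assumes "0 \<le> t" "t < s" "f s < \<infinity>" and nm: "\<And>s. t < s \<Longrightarrow> f s \<noteq> -\<infinity>"
  shows "regular t"
proof -
  have lt: "f t < \<infinity>"
  proof (cases "t = 0")
    case False
    then show ?thesis using assms zero by (intro finite_between[of 0 t s]) auto
  qed (simp add: zero)
  have gt: "f t \<noteq> -\<infinity>"
  proof
    assume m: "f t = -\<infinity>"
    define u where "u = (t + s) / 2"
    have u: "t < u" "u < s" using assms by (auto simp: u_def)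
    have "f u < \<infinity>" using u lt assms by (intro finite_between[of t u s]) auto
    then obtain v where v: "f u = ereal v" using nm[OF u(1)] by (cases "f u") auto
    obtain q where q: "f s = ereal q" using nm[OF assms(2)] assms(3) by (cases "f s") auto
    have "q - v \<le> ((q - v) / (s - u)) * (s - u)" using u by simp
    from left_support[OF u v q this] m show False by simp
  qed
  show ?thesis unfolding regular_def using lt gt assms by auto
qed

lemma right_deriv_cases:
  assumes "0 \<le> t"
  obtains "\<forall>s>t. f s = \<infinity>" "right_deriv f t = \<infinity>"
    | s where "t < s" "f s = -\<infinity>" "right_deriv f t = -\<infinity>"
    | "regular t"
proof (cases "\<forall>s>t. f s = \<infinity>")
  case True
  then show ?thesis using that(1) unfolding right_deriv_def by auto
next
  case F: False
  show ?thesis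
  proof (cases "\<exists>s>t. f s = -\<infinity>")
    case True
    then obtain s where s: "t < s" "f s = -\<infinity>" by auto
    have "right_deriv f t = -\<infinity>"
      unfolding right_deriv_def using F True by (simp only: if_False if_True)
    then show ?thesis using that(2) s by auto
  next
    case False
    from F obtain s where "t < s" "f s < \<infinity>" by (auto simp: less_top)
    then show ?thesis using assms False regularI that(3) by blast
  qed
qed

lemma slope_mono:
  assumes "regular t" "t < s" "s \<le> w"
  shows "(f s - f t) / ereal (s - t) \<le> (f w - f t) / ereal (w - t)"
proof (cases "f w = \<infinity> \<or> s = w")
  case True
  obtain p where p: "f t = ereal p" using assms regular_real by auto
  show ?thesis using True p assms by auto
next
  case False
  obtain p where p: "f t = ereal p" using assms regular_real by auto
  obtain q where q: "f w = ereal q" using False assms unfolding regular_def by (cases "f w") auto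
  have sw: "s < w" using False assms by auto
  then have "f s < \<infinity>" using p q assms by (intro finite_between[of t s w]) auto
  then obtain v where v: "f s = ereal v" using assms unfolding regular_def by (cases "f s") auto
  have "v + (v - p) / (s - t) * (w - s) \<le> q"
    using right_support[OF assms(2) sw p v, of "(v - p) / (s - t)"] assms q by simp
  then have "(v - p) * (w - t) \<le> (q - p) * (s - t)"
    using assms by (simp add: field_simps)
  then have "(v - p) / (s - t) \<le> (q - p) / (w - t)"
    using assms sw by (simp add: frac_le_eq divide_le_eq field_simps)
  then show ?thesis using p q v assms sw by simp
qed

lemma right_deriv_eq_INF:
  assumes "regular t"
  shows "right_deriv f t = (INF s\<in>{t<..}. (f s - f t) / ereal (s - t))"
proof -
  have "((\<lambda>s. (f s - f t) / ereal (s - t)) \<longlongrightarrow> (INF s\<in>{t<..}. (f s - f t) / ereal (s - t))) (at_right t)"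
    by (rule tendsto_at_right_INF) (auto simp: eventually_at_right_less intro: slope_mono[OF assms])
  then have "Lim (at_right t) (\<lambda>s. (f s - f t) / ereal (s - t)) = (INF s\<in>{t<..}. (f s - f t) / ereal (s - t))"
    by (intro tendsto_Lim) auto
  moreover have "\<not> (\<forall>s>t. f s = \<infinity>)" "\<not> (\<exists>s>t. f s = -\<infinity>)"
    using assms unfolding regular_def by auto
  ultimately show ?thesis unfolding right_deriv_def by (simp only: if_False)
qed

lemma right_deriv_le_slope:
  assumes "regular t" "t < s" "f t = ereal p" "f s = ereal q"
  shows "right_deriv f t \<le> ereal ((q - p) / (s - t))"
  unfolding right_deriv_eq_INF[OF assms(1)]
  using assms by (intro INF_lower2[of s]) auto

lemma slope_le_right_deriv:
  assumes "regular t" "w < t" "f w = ereal p" "f t = ereal v"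
  shows "ereal ((v - p) / (t - w)) \<le> right_deriv f t"
  unfolding right_deriv_eq_INF[OF assms(1)]
proof (rule INF_greatest)
  fix s assume s: "s \<in> {t<..}"
  have "ereal (v + (v - p) / (t - w) * (s - t)) \<le> f s"
    using s assms by (intro right_support[of w t s p v]) auto
  then show "ereal ((v - p) / (t - w)) \<le> (f s - f t) / ereal (s - t)"
    using s assms by (cases "f s") (auto simp: pos_le_divide_eq)
qed

text \<open>An upper bound for the right derivative is witnessed by a genuine chord with finite end points; all later
estimates use chords in place of derivatives.\<close>

lemma right_deriv_lessD:
  assumes "regular t" "f t = ereal p" "right_deriv f t < ereal k"
  obtains s q where "t < s" "f s = ereal q" "q - p < k * (s - t)"
proof -
  obtain s where s: "t < s" "(f s - f t) / ereal (s - t) < ereal k"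
    using assms right_deriv_eq_INF by (auto simp: INF_less_iff)
  moreover obtain q where q: "f s = ereal q"
    using s assms unfolding regular_def by (cases "f s") auto
  ultimately show ?thesis using assms that[of s q] by (auto simp: pos_divide_less_eq)
qed

lemma right_deriv_mono:
  assumes "0 \<le> s" "s \<le> t"
  shows "right_deriv f s \<le> right_deriv f t"
proof (cases "s = t")
  case False
  then have st: "s < t" using assms by simp
  from assms have t0: "0 \<le> t" by simp
  show ?thesis
  proof (cases rule: right_deriv_cases[OF t0])
    case (2 w)
    then have "right_deriv f s = -\<infinity>"
      using st unfolding right_deriv_def by (metis MInfty_neq_PInfty(1) less_trans)
    then show ?thesis by simp
  next
    case t: 3
    show ?thesis
    proof (cases rule: right_deriv_cases[OF assms(1)])
      case 1
      then show ?thesis using t st unfolding regular_def by auto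
    next
      case 3
      obtain p q where pq: "f s = ereal p" "f t = ereal q"
        using t 3 regular_real by blast
      show ?thesis
        using right_deriv_le_slope[OF 3 st pq] slope_le_right_deriv[OF t st pq] by simp
    qed auto
  qed auto
qed simp

lemma right_deriv_affine:
  assumes "regular t" "w < t" "t < s" and "\<And>u. w \<le> u \<Longrightarrow> u \<le> s \<Longrightarrow> f u = ereal (a * u + b)"
  shows "right_deriv f t = ereal a"
proof (rule antisym)
  have *: "f w = ereal (a * w + b)" "f t = ereal (a * t + b)" "f s = ereal (a * s + b)"
    using assms by auto
  have e: "(a * s + b - (a * t + b)) / (s - t) = a" "(a * t + b - (a * w + b)) / (t - w) = a"
    using assms by (auto simp: field_simps)
  show "right_deriv f t \<le> ereal a"
    using right_deriv_le_slope[OF assms(1,3) *(2,3)] e by simp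
  show "ereal a \<le> right_deriv f t"
    using slope_le_right_deriv[OF assms(1,2) *(1,2)] e by simp
qed

end


section \<open>The right tangent at the base point\<close>

locale right_tangent = convex_from_zero +
  fixes lam :: real and m V :: ereal
  assumes lam_nonneg: "0 \<le> lam"
    and m_eq: "m = right_lim (right_deriv f) lam"
    and V_eq: "V = right_lim f lam - ereal lam * m"
    and m_limpt: "m > -\<infinity> \<Longrightarrow> m islimpt {right_deriv f t |t. t > lam}"
    and m_MInfty: "m = -\<infinity> \<Longrightarrow> lam = 0 \<and> f lam = right_lim f lam"
begin

text \<open>The right derivative is nondecreasing, so its right limit at \<open>lam\<close> is an infimum.\<close>

lemma m_INF: "m = (INF t\<in>{lam<..}. right_deriv f t)"
proof -
  have "(right_deriv f \<longlongrightarrow> (INF t\<in>{lam<..}. right_deriv f t)) (at_right lam)"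
    using lam_nonneg
    by (intro tendsto_at_right_INF) (auto simp: eventually_at_right_less intro: right_deriv_mono)
  then show ?thesis unfolding m_eq right_lim_def by (intro tendsto_Lim) auto
qed

lemma m_le: "lam < t \<Longrightarrow> m \<le> right_deriv f t"
  unfolding m_INF by (intro INF_lower) auto

lemma m_lessD: assumes "m < u" obtains t where "lam < t" "right_deriv f t < u"
  using assms unfolding m_INF by (auto simp: INF_less_iff)

text \<open>If \<open>m\<close> were \<open>\<infinity>\<close>, all right derivatives beyond \<open>lam\<close> would be \<open>\<infinity>\<close> too, and \<open>m\<close> would not be a limit
point of their set.\<close>

lemma m_less_PInfty: "m < \<infinity>"
proof (rule ccontr)
  assume "\<not> m < \<infinity>"
  then have m: "m = \<infinity>" by simp
  with m_limpt obtain t where "t > lam" "right_deriv f t \<noteq> \<infinity>"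
    unfolding islimpt_def by force
  then show False using m_le[of t] m by simp
qed

text \<open>A value \<open>-\<infinity>\<close> at \<open>t\<close> makes the right derivative \<open>-\<infinity>\<close> at every earlier point, hence \<open>m = -\<infinity>\<close> and
\<open>lam = 0\<close>. By convexity \<open>f\<close> is then \<open>-\<infinity>\<close> on all of \<open>]0,t[\<close>, which contradicts the continuity from the
right at \<open>0\<close> that is assumed in this case.\<close>

lemma no_MInfty: assumes "lam < t" shows "f t \<noteq> -\<infinity>"
proof
  assume t: "f t = -\<infinity>"
  have below: "right_deriv f s = -\<infinity>" if "s < t" for s
    using that t unfolding right_deriv_def by (metis MInfty_neq_PInfty(1))
  have "right_deriv f ((lam + t) / 2) = -\<infinity>" using assms by (intro below) (simp add: field_simps)
  moreover have "m \<le> right_deriv f ((lam + t) / 2)" using assms by (intro m_le) (simp add: field_simps)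
  ultimately have "m = -\<infinity>" by simp
  then have lam: "lam = 0" "right_lim f 0 = 0" using m_MInfty zero by auto
  have "f s = -\<infinity>" if "0 < s" "s < t" for s
  proof (rule ereal_bot)
    fix B
    \<comment> \<open>The bound at \<open>t\<close> is chosen such that the chord from \<open>(0, 0)\<close> has height \<open>B\<close> at \<open>s\<close>.\<close>
    have "f s \<le> ereal (((t - s) * 0 + (s - 0) * (B * t / s)) / (t - 0))"
      using that t zero by (intro convD) auto
    then show "f s \<le> ereal B" using that by simp
  qed
  then have "eventually (\<lambda>s. f s = -\<infinity>) (at_right 0)"
    using assms lam by (auto simp: eventually_at_right)
  then have "(f \<longlongrightarrow> -\<infinity>) (at_right 0)" by (rule tendsto_eventually)
  then have "right_lim f 0 = -\<infinity>" unfolding right_lim_def by (intro tendsto_Lim) auto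
  with lam show False by simp
qed

lemma regular_if_finite_above: "lam \<le> t \<Longrightarrow> t < s \<Longrightarrow> f s < \<infinity> \<Longrightarrow> regular t"
  using lam_nonneg no_MInfty by (intro regularI) auto

lemma regular_if_right_deriv_finite:
  assumes "lam < t" "right_deriv f t < \<infinity>" shows "regular t"
proof -
  have t0: "0 \<le> t" using assms lam_nonneg by simp
  show ?thesis by (cases rule: right_deriv_cases[OF t0]) (use assms no_MInfty in auto)
qed

text \<open>On an affine piece that starts at \<open>lam\<close> the right derivative is the slope, and the slope is \<open>m\<close> because
the right derivatives near \<open>lam\<close> determine \<open>m\<close>. In particular such a piece forces \<open>m\<close> to be finite.\<close>

lemma right_deriv_const_on_affine:
  assumes "affine_fun_on {lam<..t} f" "lam < s" "s < t"
  shows "right_deriv f s = m" "m \<noteq> -\<infinity>"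
proof -
  obtain a b where ab: "\<And>u. lam < u \<Longrightarrow> u \<le> t \<Longrightarrow> f u = ereal (a * u + b)"
    using assms unfolding affine_fun_on_def by fastforce
  have rd: "right_deriv f u = ereal a" if u: "lam < u" "u < t" for u
  proof (rule right_deriv_affine)
    show "regular u" using ab[of t] u by (intro regular_if_finite_above[of u t]) auto
    show "(lam + u) / 2 < u" "u < t" using u by auto
    show "f w = ereal (a * w + b)" if "(lam + u) / 2 \<le> w" "w \<le> t" for w
      using that u by (intro ab) auto
  qed
  have "ereal a \<le> m" unfolding m_INF
  proof (rule INF_greatest)
    fix u assume u: "u \<in> {lam<..}"
    define w where "w = min u s"
    have "ereal a = right_deriv f w" using u assms by (intro rd[symmetric]) (auto simp: w_def)
    also have "\<dots> \<le> right_deriv f u"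
      using u assms lam_nonneg by (intro right_deriv_mono) (auto simp: w_def)
    finally show "ereal a \<le> right_deriv f u" .
  qed
  moreover have "m \<le> ereal a" using m_le[of s] rd[of s] assms by simp
  ultimately show "right_deriv f s = m" "m \<noteq> -\<infinity>" using rd[of s] assms by auto
qed

text \<open>Keeps the affine piece at \<open>lam\<close> bounded. For real \<open>m\<close> this is the limit point hypothesis; for
\<open>m = -\<infinity>\<close> a chord on the left of a regular point has a finite slope.\<close>

lemma right_deriv_not_constantly_m:
  obtains t where "lam < t" "right_deriv f t \<noteq> m"
proof (cases "m = -\<infinity>")
  case True
  obtain t where t: "lam < t" "right_deriv f t < \<infinity>" using m_lessD[OF m_less_PInfty] .
  have reg: "regular t" using regular_if_right_deriv_finite t by auto
  then obtain q where q: "f t = ereal q" using regular_real by auto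
  define s where "s = (lam + t) / 2"
  have s: "lam < s" "s < t" using t by (auto simp: s_def)
  then have "regular s" using q regular_if_finite_above by auto
  then obtain p where p: "f s = ereal p" using regular_real by auto
  have "right_deriv f t \<noteq> m" using slope_le_right_deriv[OF reg s(2) p q] True by auto
  then show ?thesis using that t by blast
next
  case False
  then have "m islimpt {right_deriv f t |t. t > lam}" using m_limpt by auto
  then obtain t where "lam < t" "right_deriv f t \<noteq> m"
    by (rule islimptE[of _ _ UNIV]) auto
  then show ?thesis using that by auto
qed

text \<open>What is used of \<^const>\<open>affine_end\<close>: it is a real number, the right derivative is \<open>m\<close> before it, and no
affine piece starting at \<open>lam\<close> goes beyond it. When \<open>m = -\<infinity>\<close> the third property leaves only
\<open>\<tau> = lam\<close>.\<close>

lemma affine_end_props: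
  obtains \<tau> where "affine_end f lam = ereal \<tau>" "lam \<le> \<tau>"
    "\<And>t. lam < t \<Longrightarrow> t < \<tau> \<Longrightarrow> right_deriv f t = m \<and> m \<noteq> -\<infinity>"
    "\<And>t. \<tau> < t \<Longrightarrow> \<not> affine_fun_on {lam<..t} f"
proof -
  define A where "A = {t. t > lam \<and> affine_fun_on {lam<..t} f}"
  obtain t0 where t0: "lam < t0" "right_deriv f t0 \<noteq> m" by (rule right_deriv_not_constantly_m)
  have bound: "t \<le> t0" if "t \<in> A" for t
    using right_deriv_const_on_affine(1)[of t t0] that t0 unfolding A_def by force
  show ?thesis
  proof (cases "A = {}")
    case True
    then have "affine_end f lam = ereal lam" unfolding affine_end_def A_def Let_def by simp
    then show ?thesis using that[of lam] True unfolding A_def by auto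
  next
    case False
    then have e: "affine_end f lam = (SUP t\<in>A. ereal t)" unfolding affine_end_def A_def Let_def by (simp only: if_False)
    obtain a where a: "a \<in> A" using False by auto
    have "ereal a \<le> affine_end f lam" unfolding e using a by (intro SUP_upper)
    moreover have "affine_end f lam \<le> ereal t0" unfolding e using bound by (intro SUP_least) auto
    ultimately obtain \<tau> where \<tau>: "affine_end f lam = ereal \<tau>" by (cases "affine_end f lam") auto
    show ?thesis
    proof (rule that[of \<tau>])
      show "affine_end f lam = ereal \<tau>" by fact
      show "lam \<le> \<tau>" using \<open>ereal a \<le> _\<close> \<tau> a unfolding A_def by auto
      show "right_deriv f t = m \<and> m \<noteq> -\<infinity>" if t: "lam < t" "t < \<tau>" for t
      proof -
        have "ereal t < (SUP t\<in>A. ereal t)" using t \<tau> e by simp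
        then obtain t' where t': "t' \<in> A" "t < t'" by (auto simp: less_SUP_iff)
        then show ?thesis using right_deriv_const_on_affine[of t' t] t unfolding A_def by auto
      qed
      show "\<not> affine_fun_on {lam<..t} f" if t: "\<tau> < t" for t
      proof
        assume "affine_fun_on {lam<..t} f"
        then have "t \<in> A" using t \<open>lam \<le> \<tau>\<close> unfolding A_def by simp
        then have "ereal t \<le> affine_end f lam" unfolding e by (intro SUP_upper)
        then show False using t \<tau> by simp
      qed
    qed
  qed
qed

lemma tilted_mono:
  assumes r: "m = ereal r" and st: "lam < s" "s \<le> t"
  shows "f s - ereal (s * r) \<le> f t - ereal (t * r)"
proof (cases "s = t \<or> f t = \<infinity>")
  case False
  then have lt: "s < t" "f t < \<infinity>" using st by auto
  have reg: "regular s" using lt st by (intro regular_if_finite_above[of s t]) auto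
  obtain p where p: "f s = ereal p" using reg regular_real by auto
  obtain q where q: "f t = ereal q" using lt st no_MInfty[of t] by (cases "f t") auto
  have "ereal r \<le> ereal ((q - p) / (t - s))"
    using m_le[OF st(1)] right_deriv_le_slope[OF reg lt(1) p q] unfolding r
    by (rule order_trans)
  then have "r * (t - s) \<le> q - p" using lt by (simp add: pos_le_divide_eq)
  then show ?thesis using p q by (simp add: algebra_simps)
qed auto

text \<open>The function \<open>t \<mapsto> f t - t * r\<close> is nondecreasing to the right of \<open>lam\<close>, so it has a right limit there.
The limit is not \<open>-\<infinity>\<close>, since a chord to the right of a point \<open>d\<close> bounds \<open>f\<close> from below on \<open>]lam,d[\<close>.\<close>

lemma V_real_case:
  assumes r: "m = ereal r"
  obtains v where "V = ereal v" "((\<lambda>t. f t - ereal (t * r)) \<longlongrightarrow> ereal v) (at_right lam)"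
    "\<And>t. lam < t \<Longrightarrow> ereal v \<le> f t - ereal (t * r)"
proof -
  define w where "w = (INF t\<in>{lam<..}. f t - ereal (t * r))"
  have lim: "((\<lambda>t. f t - ereal (t * r)) \<longlongrightarrow> w) (at_right lam)" unfolding w_def
    by (rule tendsto_at_right_INF) (auto simp: eventually_at_right_less intro: tilted_mono[OF r])
  have le: "w \<le> f t - ereal (t * r)" if "lam < t" for t
    unfolding w_def using that by (intro INF_lower) auto
  obtain d where d: "lam < d" "right_deriv f d < \<infinity>" using m_lessD[OF m_less_PInfty] .
  have regd: "regular d" using regular_if_right_deriv_finite d by auto
  obtain p where p: "f d = ereal p" using regd regular_real by auto
  obtain k where "right_deriv f d < ereal k" using d ereal_dense2 by blast
  then obtain s q where s: "d < s" "f s = ereal q" "q - p < k * (s - d)"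
    using right_deriv_lessD[OF regd p] by blast
  have low: "ereal (p - \<bar>k\<bar> * (d - lam) - d * \<bar>r\<bar>) \<le> f t - ereal (t * r)" if t: "lam < t" "t < d" for t
  proof -
    have "k * (s - d) \<le> \<bar>k\<bar> * (s - d)" using s by (intro mult_right_mono) auto
    then have "q - p \<le> \<bar>k\<bar> * (s - d)" using s by linarith
    then have "ereal (p - \<bar>k\<bar> * (d - t)) \<le> f t"
      using s t p by (intro left_support[of t d s]) auto
    moreover have "\<bar>k\<bar> * (d - t) \<le> \<bar>k\<bar> * (d - lam)" using t by (intro mult_left_mono) auto
    moreover have "t * r \<le> t * \<bar>r\<bar>" using t lam_nonneg by (intro mult_left_mono) auto
    moreover have "t * \<bar>r\<bar> \<le> d * \<bar>r\<bar>" using t by (intro mult_right_mono) auto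
    ultimately show ?thesis by (cases "f t") auto
  qed
  have "ereal (p - \<bar>k\<bar> * (d - lam) - d * \<bar>r\<bar>) \<le> w"
  proof (rule tendsto_lowerbound[OF lim])
    show "\<forall>\<^sub>F t in at_right lam. ereal (p - \<bar>k\<bar> * (d - lam) - d * \<bar>r\<bar>) \<le> f t - ereal (t * r)"
      using low d unfolding eventually_at_right[OF d(1)] by blast
  qed auto
  moreover have "w \<le> ereal (p - d * r)" using le[OF d(1)] p by simp
  ultimately obtain v where v: "w = ereal v" by (cases w) auto
  have "((\<lambda>t. f t - ereal (t * r) + ereal (t * r)) \<longlongrightarrow> ereal v + ereal (lam * r)) (at_right lam)"
    by (intro tendsto_add_ereal lim[unfolded v] tendsto_ereal tendsto_intros) auto
  moreover have "f t - ereal (t * r) + ereal (t * r) = f t" for t by (cases "f t") auto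
  ultimately have "right_lim f lam = ereal (v + lam * r)"
    unfolding right_lim_def by (intro tendsto_Lim) auto
  then have "V = ereal v" unfolding V_eq r by simp
  then show ?thesis using that lim le v by blast
qed

text \<open>To the right of \<open>lam\<close> this is monotonicity. To the left, a chord starting at \<open>s\<close> just beyond \<open>lam\<close> has
slope \<open>k\<close> only slightly larger than \<open>r\<close>, and its prolongation bounds \<open>f t\<close> from below by nearly
\<open>V + t * r\<close>.\<close>

lemma V_le:
  assumes r: "m = ereal r"
  shows "V \<le> f t - ereal (t * r)"
proof (cases "lam < t")
  case True
  then show ?thesis by (rule_tac V_real_case[OF r]) auto
next
  case False
  obtain v where v: "V = ereal v" and le: "\<And>t. lam < t \<Longrightarrow> ereal v \<le> f t - ereal (t * r)"
    by (rule V_real_case[OF r]) blast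
  have "ereal (v + t * r) \<le> f t + ereal e" if e: "0 < e" for e
  proof -
    \<comment> \<open>As \<open>s\<close> is kept below \<open>lam + 1\<close>, the excess slope costs at most \<open>e\<close> on the way from \<open>s\<close> to \<open>t\<close>.\<close>
    define k where "k = r + e / (lam + 1 - t)"
    have k: "r < k" using e False by (auto simp: k_def)
    obtain s0 where s0: "lam < s0" "right_deriv f s0 < ereal k" using m_lessD[of "ereal k"] r k by auto
    define s where "s = min s0 (lam + 1)"
    have s: "lam < s" "s \<le> lam + 1" using s0 by (auto simp: s_def)
    have rd: "right_deriv f s < ereal k"
      using right_deriv_mono[of s s0] s0 s lam_nonneg by (auto simp: s_def)
    have reg: "regular s" using rd s by (intro regular_if_right_deriv_finite) auto
    then obtain p where p: "f s = ereal p" using regular_real by auto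
    obtain w q where w: "s < w" "f w = ereal q" "q - p < k * (w - s)"
      using right_deriv_lessD[OF reg p rd] by blast
    have ts: "t < s" using s False by simp
    have "ereal (p - k * (s - t)) \<le> f t"
      using left_support[OF ts w(1) p w(2)] w by simp
    moreover have "v + s * r \<le> p" using le[OF s(1)] p by simp
    moreover have "(k - r) * (s - t) \<le> e"
      using s False e by (simp add: k_def pos_divide_le_eq)
    then have "k * (s - t) \<le> e + r * s - t * r" by (simp add: algebra_simps)
    ultimately show ?thesis by (cases "f t") (auto simp: algebra_simps)
  qed
  then have "ereal (v + t * r) \<le> f t" by (rule ereal_le_epsilon2)
  then show ?thesis unfolding v by (cases "f t") auto
qed

lemma V_eq_INF:
  assumes r: "m = ereal r"
  shows "V = (INF t\<in>{0<..}. f t - ereal t * m)"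
proof (rule antisym)
  show "V \<le> (INF t\<in>{0<..}. f t - ereal t * m)"
    using V_le[OF r] r by (intro INF_greatest) auto
  obtain v where v: "V = ereal v" and lim: "((\<lambda>t. f t - ereal (t * r)) \<longlongrightarrow> ereal v) (at_right lam)"
    by (rule V_real_case[OF r])
  show "(INF t\<in>{0<..}. f t - ereal t * m) \<le> V" unfolding v
  proof (rule tendsto_lowerbound[OF lim])
    show "\<forall>\<^sub>F t in at_right lam. (INF t\<in>{0<..}. f t - ereal t * m) \<le> f t - ereal (t * r)"
      using eventually_at_right_less
    proof eventually_elim
      case (elim t)
      have "(INF t\<in>{0<..}. f t - ereal t * m) \<le> f t - ereal t * m"
        using elim lam_nonneg by (intro INF_lower) auto
      then show ?case using r by simp
    qed
  qed auto
qed

lemma V_eq_legendre: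
  assumes r: "m = ereal r"
  shows "V = - legendre f m"
proof -
  have swap: "ereal t * m - f t = - (f t - ereal t * m)" for t
    using r by (cases "f t") auto
  have "- legendre f m = (INF t. f t - ereal t * m)"
    unfolding legendre_def swap using r by (simp add: ereal_SUP_uminus_eq)
  moreover have "V = (INF t. f t - ereal t * m)"
  proof (rule antisym)
    show "V \<le> (INF t. f t - ereal t * m)"
      using V_le[OF r] r by (intro INF_greatest) auto
    show "(INF t. f t - ereal t * m) \<le> V"
      unfolding V_eq_INF[OF r] by (intro INF_superset_mono) auto
  qed
  ultimately show ?thesis by simp
qed

text \<open>The right derivatives different from \<open>m\<close> that accumulate at \<open>m\<close> cannot be taken before \<open>\<tau>\<close>, where the
right derivative is \<open>m\<close>. If one is taken at \<open>\<tau>\<close> itself, a second one that is closer to \<open>m\<close> would have to be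
taken before \<open>\<tau>\<close> by monotonicity.\<close>

lemma steep_slope_past_affine_end:
  assumes r: "m = ereal r" and \<tau>: "affine_end f lam = ereal \<tau>" and u: "m < u"
  obtains t where "\<tau> < t" "right_deriv f t < u"
proof -
  have const: "right_deriv f t = m" if "lam < t" "t < \<tau>" for t
    by (rule affine_end_props) (use \<tau> that in auto)
  have "\<exists>t>lam. right_deriv f t < w \<and> right_deriv f t \<noteq> m" if "m < w" for w
    using islimptE[OF m_limpt, of "{..<w}"] r that by auto
  note pick = this
  obtain t where t: "lam < t" "right_deriv f t < u" "right_deriv f t \<noteq> m" using pick[OF u] by auto
  show ?thesis
  proof (cases "\<tau> < t")
    case True
    then show ?thesis using that t by auto
  next
    case False
    then have eq: "t = \<tau>" using const[of t] t by force
    have "m < right_deriv f t" using m_le[OF t(1)] t(3) by auto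
    then obtain s where s: "lam < s" "right_deriv f s < right_deriv f t" "right_deriv f s \<noteq> m"
      using pick by blast
    have "\<not> s < t" using const[of s] s eq by auto
    then have "right_deriv f t \<le> right_deriv f s"
      using t lam_nonneg by (intro right_deriv_mono) auto
    then show ?thesis using s by auto
  qed
qed

text \<open>If \<open>f s - s * r\<close> came back to its minimum \<open>V\<close> at some \<open>t\<close>, it would be constant on \<open>]lam,t]\<close> by
monotonicity, and \<open>f\<close> would be affine there.\<close>

lemma V_less_past_affine_end:
  assumes r: "m = ereal r" and \<tau>: "affine_end f lam = ereal \<tau>" "\<tau> < t"
  shows "V < f t - ereal (t * r)"
proof (rule ccontr)
  assume "\<not> V < f t - ereal (t * r)"
  then have le: "f t - ereal (t * r) \<le> V" by simp
  obtain v where v: "V = ereal v" by (rule V_real_case[OF r])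
  have "f s = ereal (r * s + v)" if s: "lam < s" "s \<le> t" for s
  proof -
    have "f s - ereal (s * r) = ereal v"
      using tilted_mono[OF r s] le V_le[OF r, of s] v by simp
    then show ?thesis by (cases "f s") (auto simp: algebra_simps)
  qed
  then have "affine_fun_on {lam<..t} f" unfolding affine_fun_on_def by auto
  with \<tau> show False by (rule_tac affine_end_props) auto
qed

text \<open>The input of the tilting argument at \<open>t\<close>: the chord to \<open>t\<close> from the left is steeper than some \<open>a > m\<close>, and
the chord from \<open>t\<close> to the right is less steep than \<open>b\<close>. The last condition says that tilting at \<open>t\<close> loses at
most \<open>e\<close> against \<open>V\<close>.\<close>

definition exposed_at :: "real \<Rightarrow> real \<Rightarrow> real \<Rightarrow> bool" where
  "exposed_at b e t \<longleftrightarrow> (\<exists>t1 t2 p1 p p2 a. t1 < t \<and> t < t2 \<and> f t1 = ereal p1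
       \<and> f t = ereal p \<and> f t2 = ereal p2 \<and> m < ereal a \<and> a * (t - t1) < p - p1
       \<and> p2 - p < b * (t2 - t) \<and> V - ereal e < ereal (p - t * b))"

lemma exposed_slopes_real_case:
  assumes r: "m = ereal r" and u: "m < u" and e: "0 < e"
  obtains b \<tau> \<delta> where "ereal b < u" "affine_end f lam = ereal \<tau>" "lam \<le> \<tau>" "0 < \<delta>"
    "\<And>t. \<tau> < t \<Longrightarrow> t < \<tau> + \<delta> \<Longrightarrow> exposed_at b e t"
proof -
  obtain \<tau> where \<tau>: "affine_end f lam = ereal \<tau>" "lam \<le> \<tau>" by (rule affine_end_props)
  have \<tau>0: "0 \<le> \<tau>" using \<tau> lam_nonneg by simp
  obtain v where v: "V = ereal v"
    and lim: "((\<lambda>t. f t - ereal (t * r)) \<longlongrightarrow> ereal v) (at_right lam)"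
    by (rule V_real_case[OF r])
  obtain b0 where b0: "m < ereal b0" "ereal b0 < u" using ereal_dense2 u by blast
  \<comment> \<open>Only points \<open>t < \<tau> + 1\<close> will be used, so \<open>t * (b - r)\<close> stays below \<open>e\<close>.\<close>
  define b where "b = r + min (b0 - r) (e / (\<tau> + 1))"
  have b: "r < b" "ereal b < u" "b - r \<le> e / (\<tau> + 1)"
  proof -
    show "r < b" "b - r \<le> e / (\<tau> + 1)" using b0 r e \<tau>0 by (auto simp: b_def)
    have "ereal b \<le> ereal b0" by (auto simp: b_def)
    then show "ereal b < u" using b0 by (rule_tac le_less_trans)
  qed
  obtain t0 where t0: "\<tau> < t0" "right_deriv f t0 < ereal b"
    using steep_slope_past_affine_end[OF r \<tau>(1), of "ereal b"] b r by auto
  show ?thesis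
  proof (rule that[OF b(2) \<tau>])
    show "0 < min (t0 - \<tau>) 1" using t0 by simp
    fix t assume "\<tau> < t" "t < \<tau> + min (t0 - \<tau>) 1"
    then have t: "\<tau> < t" "t < t0" "t < \<tau> + 1" "lam < t" "0 < t" using \<tau> \<tau>0 by auto
    have rd: "right_deriv f t < ereal b"
      using right_deriv_mono[of t t0] t t0 by auto
    have reg: "regular t" using rd t by (intro regular_if_right_deriv_finite) auto
    then obtain p where p: "f t = ereal p" using regular_real by auto
    obtain t2 p2 where t2: "t < t2" "f t2 = ereal p2" "p2 - p < b * (t2 - t)"
      using right_deriv_lessD[OF reg p rd] by blast
    have vp: "v < p - t * r" using V_less_past_affine_end[OF r \<tau>(1) t(1)] v p by simp
    then have "eventually (\<lambda>s. f s - ereal (s * r) < ereal (p - t * r)) (at_right lam)"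
      using lim by (intro order_tendstoD) auto
    moreover have "eventually (\<lambda>s. lam < s \<and> s < t) (at_right lam)"
      using t by (auto simp: eventually_at_right)
    ultimately have "eventually (\<lambda>s. f s - ereal (s * r) < ereal (p - t * r) \<and> lam < s \<and> s < t) (at_right lam)"
      by eventually_elim auto
    then obtain t1 where t1: "f t1 - ereal (t1 * r) < ereal (p - t * r)" "lam < t1" "t1 < t"
      using eventually_happens'[of "at_right lam"] by auto
    have "regular t1" using t1 p by (intro regular_if_finite_above[of t1 t]) auto
    then obtain p1 where p1: "f t1 = ereal p1" using regular_real by auto
    have "r * (t - t1) < p - p1" using t1 p1 by (simp add: algebra_simps)
    then have "r < (p - p1) / (t - t1)" using t1 by (simp add: pos_less_divide_eq)
    then obtain a where a: "r < a" "a < (p - p1) / (t - t1)" using dense by blast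
    have "a * (t - t1) < p - p1" using a t1 by (simp add: pos_less_divide_eq)
    moreover have "V - ereal e < ereal (p - t * b)"
    proof -
      have "t * (b - r) < (\<tau> + 1) * (b - r)" using t b by simp
      also have "\<dots> \<le> e" using b \<tau>0 by (simp add: pos_le_divide_eq mult.commute)
      finally have "v - e < p - t * b" using vp by (simp add: algebra_simps)
      then show ?thesis using v by simp
    qed
    ultimately show "exposed_at b e t" unfolding exposed_at_def
      using t1 t2 p p1 a r by - (rule exI[of _ t1], rule exI[of _ t2], rule exI[of _ p1], rule exI[of _ p], rule exI[of _ p2], rule exI[of _ a], auto)
  qed
qed

text \<open>The hypothesis gives the value \<open>0\<close> to the term \<open>right_lim f 0\<close>; that \<open>f\<close> does converge follows because
negative right derivatives make it nonincreasing near \<open>0\<close>.\<close>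

lemma tendsto_zero_MInfty_case:
  assumes m: "m = -\<infinity>"
  shows "(f \<longlongrightarrow> 0) (at_right 0)"
proof -
  have lam: "lam = 0" "right_lim f 0 = 0" using m_MInfty[OF m] zero by auto
  have "m < 0" using m by simp
  then obtain t0 where t0: "0 < t0" "right_deriv f t0 < 0" using m_lessD lam by metis
  have anti: "f t \<le> f s" if "0 < s" "s \<le> t" "t < t0" for s t
  proof (cases "s = t")
    case False
    have rd: "right_deriv f t < ereal 0" using right_deriv_mono[of t t0] that t0 by (auto simp: zero_ereal_def)
    have reg: "regular t" using rd that lam by (intro regular_if_right_deriv_finite) auto
    then obtain p where p: "f t = ereal p" using regular_real by auto
    obtain w q where w: "t < w" "f w = ereal q" "q - p < 0 * (w - t)"
      using right_deriv_lessD[OF reg p rd] by blast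
    show ?thesis using left_support[of s t w p q 0] False that p w by auto
  qed simp
  define h where "h = (INF t\<in>{0<..<t0}. - f t)"
  have "((\<lambda>t. - f t) \<longlongrightarrow> h) (at_right 0)" unfolding h_def
    by (rule tendsto_at_right_INF) (use t0 anti in \<open>auto simp: eventually_at_right\<close>)
  then have "((\<lambda>t. - (- f t)) \<longlongrightarrow> - h) (at_right 0)" by (rule tendsto_uminus_ereal)
  then have lim: "(f \<longlongrightarrow> - h) (at_right 0)" by simp
  then have "right_lim f 0 = - h" unfolding right_lim_def by (intro tendsto_Lim) auto
  with lim lam show ?thesis by simp
qed

lemma V_MInfty_case: assumes m: "m = -\<infinity>" shows "V = 0"
proof -
  have "lam = 0" "right_lim f 0 = 0" using m_MInfty[OF m] zero by auto
  then show ?thesis unfolding V_eq by (simp add: zero_ereal_def[symmetric])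
qed

lemma V_real: obtains v where "V = ereal v"
proof (cases m)
  case (real r)
  then show ?thesis by (rule V_real_case) (use that in blast)
qed (use m_less_PInfty V_MInfty_case that in \<open>auto simp: zero_ereal_def\<close>)

lemma small_steep_point:
  assumes m: "m = -\<infinity>" and e: "0 < e"
  obtains d where "0 < d"
    "\<And>t. 0 < t \<Longrightarrow> t < d \<Longrightarrow> regular t \<and> right_deriv f t < ereal k \<and> ereal (-e) < f t"
proof -
  have lam: "lam = 0" using m_MInfty[OF m] by auto
  obtain t0 where t0: "0 < t0" "right_deriv f t0 < ereal k" using m_lessD[of "ereal k"] m lam by auto
  have "eventually (\<lambda>t. ereal (-e) < f t) (at_right 0)"
    using tendsto_zero_MInfty_case[OF m] e by (intro order_tendstoD) (auto simp: zero_ereal_def)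
  then obtain d0 where d0: "0 < d0" "\<And>t. 0 < t \<Longrightarrow> t < d0 \<Longrightarrow> ereal (-e) < f t"
    unfolding eventually_at_right_field by auto
  show ?thesis
  proof (rule that[of "min t0 d0"])
    show "0 < min t0 d0" using t0 d0 by simp
    fix t assume t: "0 < t" "t < min t0 d0"
    have rd: "right_deriv f t < ereal k" using right_deriv_mono[of t t0] t t0 by auto
    have "regular t" using rd t lam by (intro regular_if_right_deriv_finite) auto
    then show "regular t \<and> right_deriv f t < ereal k \<and> ereal (-e) < f t"
      using rd d0 t by auto
  qed
qed

text \<open>Chords just to the right of \<open>0\<close> have slopes tending to \<open>-\<infinity>\<close> and end points of height near \<open>0\<close>, so
their prolongations to a fixed \<open>t < 0\<close> become arbitrarily high.\<close>

lemma infinite_on_negatives: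
  assumes m: "m = -\<infinity>" and t: "t < 0"
  shows "f t = \<infinity>"
proof (rule ereal_top)
  fix B
  define K where "K = (\<bar>B\<bar> + 1) / (- t)"
  have K: "K * (- t) = \<bar>B\<bar> + 1" "0 < K" using t by (auto simp: K_def field_simps)
  obtain d where d: "0 < d" "\<And>s. 0 < s \<Longrightarrow> s < d \<Longrightarrow> regular s \<and> right_deriv f s < ereal (-K) \<and> ereal (-1) < f s"
    using small_steep_point[OF m, of 1 "-K"] by auto
  define s where "s = d / 2"
  have s: "0 < s" "regular s" "right_deriv f s < ereal (-K)" "ereal (-1) < f s"
    using d by (auto simp: s_def)
  obtain p where p: "f s = ereal p" using s regular_real by auto
  obtain w q where w: "s < w" "f w = ereal q" "q - p < (-K) * (w - s)"
    using right_deriv_lessD[OF s(2) p s(3)] by blast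
  have "ereal (p - (-K) * (s - t)) \<le> f t" using w s t p by (intro left_support[of t s w]) auto
  moreover have "0 \<le> K * s" using K s by simp
  then have "0 \<le> 1 + p + K * s" using s p by simp
  then have "B \<le> p - (-K) * (s - t)" using K by (simp add: algebra_simps)
  ultimately show "ereal B \<le> f t" by (meson ereal_less_eq(3) order_trans)
qed

lemma legendre_nonneg: assumes "m = -\<infinity>" shows "0 \<le> legendre f \<xi>"
proof (cases "\<xi> = -\<infinity>")
  case True
  then show ?thesis using m_MInfty[OF assms] zero unfolding legendre_def by auto
next
  case False
  have "0 \<le> ereal 0 * \<xi> - f 0" using zero by (simp add: zero_ereal_def[symmetric])
  also have "\<dots> \<le> (SUP t. ereal t * \<xi> - f t)" by (intro SUP_upper) auto
  finally show ?thesis using False unfolding legendre_def by simp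
qed

text \<open>For \<open>\<xi>\<close> below the slope \<open>a\<close> of a chord ending at \<open>s\<close>, the function \<open>t \<mapsto> t * \<xi> - f t\<close> lies below a
decreasing line beyond \<open>s\<close>; on \<open>]0,s]\<close> it is at most \<open>- f t\<close>, which is small when \<open>s\<close> is, and
on the negative half-line it is \<open>-\<infinity>\<close>.\<close>

lemma legendre_small:
  assumes m: "m = -\<infinity>" and e: "0 < e"
  obtains B where "\<And>\<xi>. \<xi> < ereal B \<Longrightarrow> legendre f \<xi> \<le> ereal e"
proof -
  obtain d where d: "0 < d" "\<And>s. 0 < s \<Longrightarrow> s < d \<Longrightarrow> regular s \<and> right_deriv f s < ereal 0 \<and> ereal (-e) < f s"
    using small_steep_point[OF m e, of 0] by auto
  define s1 s where "s1 = d / 3" and "s = d / 2"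
  have s: "0 < s1" "s1 < s" "s < d" "0 < s" using d by (auto simp: s1_def s_def)
  obtain p1 where p1: "f s1 = ereal p1" using d(2)[of s1] s regular_real by auto
  obtain p where p: "f s = ereal p" using d(2)[of s] s regular_real by auto
  define a where "a = (p - p1) / (s - s1)"
  have small: "legendre f \<xi> \<le> ereal e" if xi: "\<xi> < ereal (min a 0)" for \<xi>
  proof (cases \<xi>)
    case MInf
    then show ?thesis using m_MInfty[OF m] zero e unfolding legendre_def by auto
  next
    case (real x)
    then have x: "x < a" "x < 0" using xi by auto
    have "ereal t * \<xi> - f t \<le> ereal e" for t
    proof -
      consider "t < 0" | "t = 0" | "0 < t" "t \<le> s" | "s < t" by linarith
      then show ?thesis
      proof cases
        case 1
        then show ?thesis using infinite_on_negatives[OF m] real by simp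
      next
        case 2
        then show ?thesis using zero e real by (simp add: zero_ereal_def[symmetric])
      next
        case 3
        have "t * x < 0" using 3 x by (simp add: mult_pos_neg)
        moreover have "ereal (-e) < f t" using d(2)[of t] 3 s by auto
        ultimately show ?thesis using real by (cases "f t") auto
      next
        case 4
        have "ereal (p + a * (t - s)) \<le> f t"
          using 4 s p p1 by (intro right_support[of s1 s t]) (auto simp: a_def)
        moreover have "- e < p" using d(2)[of s] s p by auto
        moreover have "(t - s) * (x - a) \<le> 0" using 4 x by (intro mult_nonneg_nonpos) auto
        moreover have "s * x \<le> 0" using s x by (intro mult_nonneg_nonpos) auto
        ultimately show ?thesis using real by (cases "f t") (auto simp: algebra_simps)
      qed
    qed
    then have "(SUP t. ereal t * \<xi> - f t) \<le> ereal e" by (intro SUP_least)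
    then show ?thesis using real unfolding legendre_def by simp
  qed (use xi in auto)
  then show ?thesis using that by blast
qed

lemma exposed_slopes_MInfty_case:
  assumes m: "m = -\<infinity>" and u: "m < u" and e: "0 < e"
  obtains b \<tau> \<delta> where "ereal b < u" "affine_end f lam = ereal \<tau>" "lam \<le> \<tau>" "0 < \<delta>"
    "\<And>t. \<tau> < t \<Longrightarrow> t < \<tau> + \<delta> \<Longrightarrow> exposed_at b e t"
proof -
  have lam: "lam = 0" using m_MInfty[OF m] by auto
  obtain \<tau> where \<tau>: "affine_end f lam = ereal \<tau>" "lam \<le> \<tau>"
    "\<And>t. lam < t \<Longrightarrow> t < \<tau> \<Longrightarrow> right_deriv f t = m \<and> m \<noteq> -\<infinity>"
    by (rule affine_end_props) blast
  have \<tau>0: "\<tau> = 0" using \<tau>(3)[of "\<tau> / 2"] \<tau>(2) m lam by force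
  obtain b0 where b0: "ereal b0 < u" using u m by (metis ereal_dense2)
  define b where "b = min b0 (-1)"
  have "ereal b \<le> ereal b0" by (auto simp: b_def)
  then have b: "ereal b < u" using b0 by (rule le_less_trans)
  have b_neg: "b < 0" by (simp add: b_def)
  obtain d where d: "0 < d" "\<And>s. 0 < s \<Longrightarrow> s < d \<Longrightarrow> regular s \<and> right_deriv f s < ereal b \<and> ereal (-e) < f s"
    using small_steep_point[OF m e, of b] by auto
  show ?thesis
  proof (rule that[OF b \<tau>(1,2) d(1)])
    fix t assume "\<tau> < t" "t < \<tau> + d"
    then have t: "0 < t" "t < d" using \<tau>0 by auto
    have reg: "regular t" and rd: "right_deriv f t < ereal b" and low: "ereal (-e) < f t"
      using d(2)[OF t] by auto
    obtain p where p: "f t = ereal p" using reg regular_real by auto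
    obtain t2 p2 where t2: "t < t2" "f t2 = ereal p2" "p2 - p < b * (t2 - t)"
      using right_deriv_lessD[OF reg p rd] by blast
    obtain p1 where p1: "f (t / 2) = ereal p1" using d(2)[of "t / 2"] t regular_real by auto
    define a where "a = (p - p1 - 1) / (t - t / 2)"
    have "a * (t - t / 2) = p - p1 - 1" using t by (simp add: a_def)
    moreover have "V - ereal e < ereal (p - t * b)"
    proof -
      have "t * b < 0" using t b_neg by (simp add: mult_pos_neg)
      then show ?thesis using V_MInfty_case[OF m] low p by simp
    qed
    ultimately show "exposed_at b e t" unfolding exposed_at_def
      using t2 p p1 m t
      by - (rule exI[of _ "t/2"], rule exI[of _ t2], rule exI[of _ p1], rule exI[of _ p], rule exI[of _ p2], rule exI[of _ a], auto)
  qed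
qed

lemma exposed_slopes:
  assumes u: "m < u" and e: "0 < e"
  obtains b \<tau> \<delta> where "ereal b < u" "affine_end f lam = ereal \<tau>" "lam \<le> \<tau>" "0 < \<delta>"
    "\<And>t. \<tau> < t \<Longrightarrow> t < \<tau> + \<delta> \<Longrightarrow> exposed_at b e t"
proof (cases m)
  case (real r)
  show ?thesis by (rule exposed_slopes_real_case[OF real u e]) (rule that)
next
  case MInf
  show ?thesis by (rule exposed_slopes_MInfty_case[OF MInf u e]) (rule that)
qed (use m_less_PInfty in auto)

end

section \<open>Exponential moments\<close>

text \<open>Translates bounds for \<open>c * log p\<close> into bounds for \<open>p\<close>, so that the estimates for a single
measure below involve no extended logarithm.\<close>

lemma scaled_elog_le_iff:
  assumes c: "0 < c"
  shows "ereal c * elog p \<le> ereal P \<longleftrightarrow> p \<le> ennreal (exp (P / c))"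
proof (cases p rule: ennreal_cases)
  case (real r)
  show ?thesis
  proof (cases "r = 0")
    case False
    then have r: "0 < r" using real by simp
    have "c * ln r \<le> P \<longleftrightarrow> ln r \<le> P / c" using c by (simp add: pos_le_divide_eq mult.commute)
    also have "\<dots> \<longleftrightarrow> r \<le> exp (P / c)" using r by (metis exp_le_cancel_iff exp_ln)
    finally show ?thesis using r real by (simp add: elog_def)
  qed (use c real in \<open>simp add: elog_def\<close>)
qed (use c in \<open>simp add: elog_def top_unique\<close>)

lemma scaled_elog_ge_iff:
  assumes c: "0 < c"
  shows "ereal P \<le> ereal c * elog p \<longleftrightarrow> ennreal (exp (P / c)) \<le> p"
proof (cases p rule: ennreal_cases)
  case (real r)
  show ?thesis
  proof (cases "r = 0")
    case False
    then have r: "0 < r" using real by simp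
    have "P \<le> c * ln r \<longleftrightarrow> P / c \<le> ln r" using c by (simp add: pos_divide_le_eq mult.commute)
    also have "\<dots> \<longleftrightarrow> exp (P / c) \<le> r" using r by (metis exp_le_cancel_iff exp_ln)
    finally show ?thesis using r real by (simp add: elog_def)
  qed (use c real in \<open>simp add: elog_def\<close>)
qed (use c in \<open>simp add: elog_def\<close>)

lemma scaled_elog_mono:
  assumes "0 < c" "p \<le> q"
  shows "ereal c * elog p \<le> ereal c * elog q"
proof (rule ereal_le_real)
  fix z assume "ereal c * elog q \<le> ereal z"
  then show "ereal c * elog p \<le> ereal z"
    using assms by (auto simp: scaled_elog_le_iff intro: order_trans)
qed

definition expmom :: "real measure \<Rightarrow> real \<Rightarrow> real \<Rightarrow> ennreal" where
  "expmom M c t = (\<integral>\<^sup>+ x. ennreal (exp (inverse c * t * x)) \<partial>M)"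

text \<open>This is the log-convexity of the moment generating function, obtained from the convexity of \<open>exp\<close>
after normalising the two given moments by their upper bounds.\<close>

lemma expmom_interpolation:
  assumes M: "sets M = sets borel" and c: "0 < c" and "t < s" "s < w"
    and P: "expmom M c t \<le> ennreal (exp (P / c))" and Q: "expmom M c w \<le> ennreal (exp (Q / c))"
  shows "expmom M c s \<le> ennreal (exp (((w - s) * P + (s - t) * Q) / (w - t) / c))"
proof -
  define X where "X = ((w - s) * P + (s - t) * Q) / (w - t)"
  define \<alpha> \<beta> where "\<alpha> = (w - s) / (w - t)" and "\<beta> = (s - t) / (w - t)"
  have ab: "0 \<le> \<alpha>" "0 \<le> \<beta>" "\<alpha> = 1 - \<beta>" "\<beta> \<le> 1" using assms by (auto simp: \<alpha>_def \<beta>_def field_simps)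
  have sX: "s = \<alpha> * t + \<beta> * w" "X = \<alpha> * P + \<beta> * Q"
    using assms by (auto simp: \<alpha>_def \<beta>_def X_def divide_simps) (auto simp: algebra_simps)
  have meas: "(\<lambda>x. ennreal (exp (inverse c * u * x))) \<in> borel_measurable M" for u
    using M by (simp cong: measurable_cong_sets)
  have pt: "exp (inverse c * s * x) \<le> \<alpha> * exp ((X - P) / c) * exp (inverse c * t * x)
      + \<beta> * exp ((X - Q) / c) * exp (inverse c * w * x)" for x
  proof -
    define A B where "A = (t * x - P) / c" and "B = (w * x - Q) / c"
    have "exp (\<alpha> * A + \<beta> * B) \<le> \<alpha> * exp A + \<beta> * exp B"
      using convex_onD[OF exp_convex, of \<beta> A B] ab by simp
    moreover have "inverse c * s * x = X / c + (\<alpha> * A + \<beta> * B)"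
      unfolding sX A_def B_def using c by (simp add: field_simps)
    then have "exp (inverse c * s * x) = exp (X / c) * exp (\<alpha> * A + \<beta> * B)" by (simp add: exp_add)
    moreover have A_B: "exp ((X - P) / c) * exp (inverse c * t * x) = exp (X / c) * exp A"
      "exp ((X - Q) / c) * exp (inverse c * w * x) = exp (X / c) * exp B"
      unfolding A_def B_def exp_add[symmetric] using c by (auto simp: field_simps)
    ultimately have "exp (inverse c * s * x) \<le> exp (X / c) * (\<alpha> * exp A + \<beta> * exp B)" by simp
    also have "\<dots> = \<alpha> * (exp (X / c) * exp A) + \<beta> * (exp (X / c) * exp B)" by (simp add: algebra_simps)
    finally show ?thesis unfolding mult.assoc[of \<alpha>] mult.assoc[of \<beta>] A_B .
  qed
  have "expmom M c s \<le> (\<integral>\<^sup>+ x. ennreal (\<alpha> * exp ((X - P) / c)) * ennreal (exp (inverse c * t * x))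
      + ennreal (\<beta> * exp ((X - Q) / c)) * ennreal (exp (inverse c * w * x)) \<partial>M)"
    unfolding expmom_def using pt ab
    by (intro nn_integral_mono) (auto simp: ennreal_mult[symmetric] ennreal_plus[symmetric] simp del: ennreal_plus intro!: ennreal_leI)
  also have "\<dots> = ennreal (\<alpha> * exp ((X - P) / c)) * expmom M c t + ennreal (\<beta> * exp ((X - Q) / c)) * expmom M c w"
    unfolding expmom_def using meas by (simp add: nn_integral_add nn_integral_cmult)
  also have "\<dots> \<le> ennreal (\<alpha> * exp ((X - P) / c)) * ennreal (exp (P / c))
      + ennreal (\<beta> * exp ((X - Q) / c)) * ennreal (exp (Q / c))"
    by (intro add_mono mult_left_mono P Q) auto
  also have "\<dots> = ennreal (\<alpha> * exp ((X - P) / c) * exp (P / c) + \<beta> * exp ((X - Q) / c) * exp (Q / c))"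
    using ab by (simp add: ennreal_mult[symmetric] ennreal_plus[symmetric] del: ennreal_plus)
  also have "\<alpha> * exp ((X - P) / c) * exp (P / c) + \<beta> * exp ((X - Q) / c) * exp (Q / c) = exp (X / c)"
    using ab by (simp add: mult.assoc exp_add[symmetric] add_divide_distrib[symmetric]) (simp add: algebra_simps)
  finally show ?thesis unfolding X_def .
qed

lemma chernoff:
  assumes M: "sets M = sets borel" and c: "0 < c" and t: "0 \<le> t"
    and P: "expmom M c t \<le> ennreal (exp (P / c))"
  shows "emeasure M {a..} \<le> ennreal (exp ((P - t * a) / c))"
proof -
  have meas: "(\<lambda>x. ennreal (exp (inverse c * t * x))) \<in> borel_measurable M"
    using M by (simp cong: measurable_cong_sets)
  have "emeasure M {a..} = (\<integral>\<^sup>+ x. indicator {a..} x \<partial>M)" using M by simp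
  also have "\<dots> \<le> (\<integral>\<^sup>+ x. ennreal (exp (- t * a / c)) * ennreal (exp (inverse c * t * x)) \<partial>M)"
  proof (intro nn_integral_mono)
    fix x
    have "1 \<le> exp (- t * a / c) * exp (inverse c * t * x)" if "a \<le> x"
    proof -
      have "0 \<le> t * (x - a) / c" using that t c by simp
      also have "t * (x - a) / c = - t * a / c + inverse c * t * x" using c by (simp add: field_simps)
      finally show ?thesis by (simp add: exp_add[symmetric])
    qed
    then show "indicator {a..} x \<le> ennreal (exp (- t * a / c)) * ennreal (exp (inverse c * t * x))"
      by (auto simp: indicator_def ennreal_mult[symmetric])
  qed
  also have "\<dots> = ennreal (exp (- t * a / c)) * expmom M c t"
    unfolding expmom_def using meas by (simp add: nn_integral_cmult)
  also have "\<dots> \<le> ennreal (exp (- t * a / c)) * ennreal (exp (P / c))"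
    by (intro mult_left_mono P) auto
  also have "\<dots> = ennreal (exp ((P - t * a) / c))"
    by (simp add: ennreal_mult[symmetric] exp_add[symmetric] diff_divide_distrib)
  finally show ?thesis .
qed

text \<open>On \<open>]a,b[\<close> the weight \<open>exp (t * x / c)\<close> is at most \<open>exp (t * b / c)\<close>; below \<open>a\<close> it is dominated by a
multiple of \<open>exp (t1 * x / c)\<close>, and above \<open>b\<close> by a multiple of \<open>exp (t2 * x / c)\<close>. The two gap conditions,
which for the limit \<open>L\<close> are conditions on chord slopes, make both tails at most a quarter of the whole, so
at least half of the weight lies in \<open>]a,b[\<close>.\<close>

lemma tilted_mass_bound:
  assumes M: "prob_space M" "sets M = sets borel" and c: "0 < c" and t: "0 \<le> t" "t1 \<le> t" "t \<le> t2"
    and P1: "expmom M c t1 \<le> ennreal (exp (P1 / c))" and P2: "expmom M c t2 \<le> ennreal (exp (P2 / c))"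
    and P: "ennreal (exp (P / c)) \<le> expmom M c t"
    and gap1: "P1 + a * (t - t1) + \<kappa> \<le> P" and gap2: "P2 - b * (t2 - t) + \<kappa> \<le> P"
    and small: "exp (- \<kappa> / c) \<le> 1 / 4"
  shows "ennreal (exp ((P - t * b - \<kappa>) / c)) \<le> emeasure M {a<..<b}"
proof -
  interpret prob_space M by fact
  have meas: "(\<lambda>x. ennreal (exp (inverse c * u * x))) \<in> borel_measurable M" for u
    using M by (simp cong: measurable_cong_sets)
  have I: "{a<..<b} \<in> sets M" using M by simp
  have "expmom M c t \<le> (\<integral>\<^sup>+ x. ennreal (exp (t * b / c)) * indicator {a<..<b} x
      + ennreal (exp ((t - t1) * a / c)) * ennreal (exp (inverse c * t1 * x))
      + ennreal (exp (- (t2 - t) * b / c)) * ennreal (exp (inverse c * t2 * x)) \<partial>M)"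
    unfolding expmom_def
  proof (intro nn_integral_mono)
    fix x
    consider "x \<le> a" | "b \<le> x" | "a < x" "x < b" by linarith
    then show "ennreal (exp (inverse c * t * x)) \<le> ennreal (exp (t * b / c)) * indicator {a<..<b} x
      + ennreal (exp ((t - t1) * a / c)) * ennreal (exp (inverse c * t1 * x))
      + ennreal (exp (- (t2 - t) * b / c)) * ennreal (exp (inverse c * t2 * x))"
    proof cases
      case 1
      have "0 \<le> (t - t1) * (a - x) / c" using 1 t c by simp
      then have "inverse c * t * x \<le> (t - t1) * a / c + inverse c * t1 * x"
        by (simp add: divide_inverse algebra_simps)
      then have "ennreal (exp (inverse c * t * x)) \<le> ennreal (exp ((t - t1) * a / c)) * ennreal (exp (inverse c * t1 * x))"
        by (simp add: ennreal_mult[symmetric] exp_add[symmetric])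
      then show ?thesis by (intro add_increasing2 add_increasing) auto
    next
      case 2
      have "0 \<le> (t2 - t) * (x - b) / c" using 2 t c by simp
      then have "inverse c * t * x \<le> - (t2 - t) * b / c + inverse c * t2 * x"
        by (simp add: divide_inverse algebra_simps)
      then have "ennreal (exp (inverse c * t * x)) \<le> ennreal (exp (- (t2 - t) * b / c)) * ennreal (exp (inverse c * t2 * x))"
        by (simp add: ennreal_mult[symmetric] exp_add[symmetric])
      then show ?thesis by (intro add_increasing) auto
    next
      case 3
      have "t * x / c \<le> t * b / c"
        using 3 t c by (intro divide_right_mono mult_left_mono) auto
      then have "inverse c * t * x \<le> t * b / c" using c by (simp add: field_simps)
      then have "ennreal (exp (inverse c * t * x)) \<le> ennreal (exp (t * b / c)) * indicator {a<..<b} x"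
        using 3 by simp
      then show ?thesis by (intro add_increasing2) auto
    qed
  qed
  also have "\<dots> = ennreal (exp (t * b / c)) * emeasure M {a<..<b}
      + ennreal (exp ((t - t1) * a / c)) * expmom M c t1 + ennreal (exp (- (t2 - t) * b / c)) * expmom M c t2"
    unfolding expmom_def using meas I by (simp add: nn_integral_add nn_integral_cmult)
  also have "\<dots> \<le> ennreal (exp (t * b / c)) * emeasure M {a<..<b}
      + ennreal (exp ((t - t1) * a / c)) * ennreal (exp (P1 / c)) + ennreal (exp (- (t2 - t) * b / c)) * ennreal (exp (P2 / c))"
    by (intro add_mono mult_left_mono P1 P2) auto
  also have "\<dots> = ennreal (exp (t * b / c) * prob {a<..<b} + exp ((t - t1) * a / c) * exp (P1 / c)
      + exp (- (t2 - t) * b / c) * exp (P2 / c))"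
    by (simp add: emeasure_eq_measure ennreal_mult[symmetric] ennreal_plus[symmetric] del: ennreal_plus)
  finally have "exp (P / c) \<le> exp (t * b / c) * prob {a<..<b} + exp ((t - t1) * a / c) * exp (P1 / c)
      + exp (- (t2 - t) * b / c) * exp (P2 / c)"
    using order_trans[OF P] by (subst ennreal_le_iff[symmetric]) auto
  moreover have "exp ((t - t1) * a / c) * exp (P1 / c) \<le> exp (P / c) * exp (- \<kappa> / c)"
  proof -
    have "(P1 + a * (t - t1)) / c \<le> (P - \<kappa>) / c" using gap1 c by (intro divide_right_mono) auto
    then show ?thesis by (simp add: exp_add[symmetric] add_divide_distrib diff_divide_distrib mult.commute add.commute)
  qed
  moreover have "exp (- (t2 - t) * b / c) * exp (P2 / c) \<le> exp (P / c) * exp (- \<kappa> / c)"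
  proof -
    have "(- (t2 - t) * b + P2) / c \<le> (P - \<kappa>) / c"
      using gap2 c by (intro divide_right_mono) (auto simp: algebra_simps)
    then show ?thesis unfolding exp_add[symmetric] by (simp add: add_divide_distrib diff_divide_distrib)
  qed
  moreover have "exp (P / c) * exp (- \<kappa> / c) \<le> exp (P / c) * (1 / 4)" using small by (intro mult_left_mono) auto
  ultimately have "exp (P / c) * exp (- \<kappa> / c) \<le> exp (t * b / c) * prob {a<..<b}"
    using exp_gt_zero[of "P / c"] by linarith
  then have "exp (- (t * b) / c) * (exp (P / c) * exp (- \<kappa> / c)) \<le> exp (- (t * b) / c) * (exp (t * b / c) * prob {a<..<b})"
    by (intro mult_left_mono) auto
  also have "\<dots> = prob {a<..<b}" by (simp add: mult.assoc[symmetric] exp_add[symmetric])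
  also have "exp (- (t * b) / c) * (exp (P / c) * exp (- \<kappa> / c)) = exp ((P - t * b - \<kappa>) / c)"
    by (simp add: exp_add[symmetric] diff_divide_distrib)
  finally show ?thesis by (simp add: emeasure_eq_measure)
qed

section \<open>Nets of measures\<close>

lemma eventually_tails:
  assumes "directed_set D le"
  shows "eventually P (tails D le) \<longleftrightarrow> (\<exists>i\<in>D. \<forall>j\<in>D. le i j \<longrightarrow> P j)"
proof -
  have "eventually P (tails D le) \<longleftrightarrow> (\<exists>i\<in>D. eventually P (principal {j\<in>D. le i j}))"
    unfolding tails_def
  proof (rule eventually_INF_base)
    show "D \<noteq> {}" using assms unfolding directed_set_def by auto
    fix i j assume "i \<in> D" "j \<in> D"
    then obtain k where k: "k \<in> D" "le i k" "le j k" using assms unfolding directed_set_def by meson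
    have "{l \<in> D. le k l} \<subseteq> {l \<in> D. le i l} \<inter> {l \<in> D. le j l}"
      using assms k \<open>i \<in> D\<close> \<open>j \<in> D\<close> unfolding directed_set_def by blast
    then show "\<exists>k\<in>D. principal {l \<in> D. le k l} \<le> inf (principal {l \<in> D. le i l}) (principal {l \<in> D. le j l})"
      using k by auto
  qed
  then show ?thesis by (simp add: eventually_principal Ball_def imp_conjL)
qed

locale scaled_net =
  fixes D :: "'i set" and le :: "'i \<Rightarrow> 'i \<Rightarrow> bool"
    and \<mu> :: "'i \<Rightarrow> real measure" and c :: "'i \<Rightarrow> real"
  assumes directed: "directed_set D le"
    and distr: "\<And>i. i \<in> D \<Longrightarrow> real_distribution (\<mu> i)"
    and c_pos: "\<And>i. i \<in> D \<Longrightarrow> c i > 0"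
    and c_lim: "(c \<longlongrightarrow> 0) (tails D le)"
begin

abbreviation "F \<equiv> tails D le"
abbreviation "L \<equiv> Lbar F \<mu> c"

lemma F_neq_bot: "F \<noteq> bot"
proof
  assume "F = bot"
  then have "eventually (\<lambda>i. False) F" by simp
  then obtain i where "i \<in> D" "\<forall>j\<in>D. le i j \<longrightarrow> False"
    unfolding eventually_tails[OF directed] by (rule bexE)
  then show False using directed unfolding directed_set_def by blast
qed

lemma eventually_in_D: "eventually (\<lambda>i. i \<in> D) F"
proof -
  have "D \<noteq> {}" using directed unfolding directed_set_def by blast
  then show ?thesis unfolding eventually_tails[OF directed] by blast
qed

lemma sets_\<mu>: "i \<in> D \<Longrightarrow> sets (\<mu> i) = sets borel"
  and prob_\<mu>: "i \<in> D \<Longrightarrow> prob_space (\<mu> i)"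
  using distr unfolding real_distribution_def real_distribution_axioms_def by auto

lemma space_\<mu>: "i \<in> D \<Longrightarrow> space (\<mu> i) = UNIV"
  using sets_eq_imp_space_eq[OF sets_\<mu>] by simp

lemma scaled_lmgf_le_iff:
  "i \<in> D \<Longrightarrow> scaled_lmgf \<mu> c t i \<le> ereal P \<longleftrightarrow> expmom (\<mu> i) (c i) t \<le> ennreal (exp (P / c i))"
  unfolding scaled_lmgf_def expmom_def using scaled_elog_le_iff c_pos by blast

lemma scaled_lmgf_ge_iff:
  "i \<in> D \<Longrightarrow> ereal P \<le> scaled_lmgf \<mu> c t i \<longleftrightarrow> ennreal (exp (P / c i)) \<le> expmom (\<mu> i) (c i) t"
  unfolding scaled_lmgf_def expmom_def using scaled_elog_ge_iff c_pos by blast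

lemma eventually_scaled_lmgf_le:
  assumes "L t \<le> ereal P" "0 < e"
  shows "eventually (\<lambda>i. scaled_lmgf \<mu> c t i \<le> ereal (P + e)) F"
proof -
  have "Limsup F (scaled_lmgf \<mu> c t) < ereal (P + e)"
    using assms unfolding Lbar_def by (auto intro: le_less_trans)
  then show ?thesis by (rule eventually_mono[OF Limsup_lessD]) simp
qed

lemma L_zero: "L 0 = 0"
proof -
  have "eventually (\<lambda>i. scaled_lmgf \<mu> c 0 i = 0) F"
    using eventually_in_D
  proof eventually_elim
    case (elim i)
    interpret prob_space "\<mu> i" using prob_\<mu>[OF elim] .
    show ?case unfolding scaled_lmgf_def elog_def using emeasure_space_1 by (simp add: zero_ereal_def[symmetric])
  qed
  then have "L 0 = Limsup F (\<lambda>i. 0)" unfolding Lbar_def by (rule Limsup_eq)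
  then show ?thesis using F_neq_bot by (simp add: Limsup_const)
qed

text \<open>Convexity holds at each index by interpolation of moments, and passes to the upper limit because both
bounds \<open>P + e\<close> and \<open>Q + e\<close> hold simultaneously from some index on.\<close>

lemma L_econvex: "econvex L"
  unfolding econvex_def
proof (intro allI impI)
  fix t s w P Q assume tsw: "t < s" "s < w" and P: "L t \<le> ereal P" and Q: "L w \<le> ereal Q"
  define X where "X = ((w - s) * P + (s - t) * Q) / (w - t)"
  have "L s \<le> ereal X + ereal e" if e: "0 < e" for e
  proof -
    have "eventually (\<lambda>i. scaled_lmgf \<mu> c s i \<le> ereal (X + e)) F"
      using eventually_in_D eventually_scaled_lmgf_le[OF P e] eventually_scaled_lmgf_le[OF Q e]
    proof eventually_elim
      case (elim i)
      have "((w - s) * (P + e) + (s - t) * (Q + e)) / (w - t) = X + e"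
        using tsw by (simp add: X_def field_simps)
      then show ?case
        using expmom_interpolation[OF sets_\<mu> c_pos tsw, of i i "P + e" "Q + e"] elim
        by (simp add: scaled_lmgf_le_iff)
    qed
    then show ?thesis unfolding Lbar_def by (simp add: Limsup_bounded)
  qed
  then show "L s \<le> ereal X" by (rule ereal_le_epsilon2)
qed

sublocale convex_from_zero L
  using L_econvex L_zero by unfold_locales

lemma emeasure_distr_ereal:
  assumes "i \<in> D" "A \<in> sets borel"
  shows "emeasure (distr (\<mu> i) borel ereal) A = emeasure (\<mu> i) (ereal -` A)"
proof -
  have "ereal \<in> measurable (\<mu> i) borel" using sets_\<mu>[OF assms(1)] by (simp cong: measurable_cong_sets)
  then show ?thesis using assms space_\<mu> by (simp add: emeasure_distr)
qed

lemma scaled_log_meas_le_0: 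
  assumes "i \<in> D" shows "scaled_log_meas \<mu> c J i \<le> 0"
proof -
  interpret prob_space "\<mu> i" using prob_\<mu> assms .
  have "ereal \<in> measurable (\<mu> i) borel" using sets_\<mu>[OF assms(1)] by (simp cong: measurable_cong_sets)
  then interpret d: prob_space "distr (\<mu> i) borel ereal" by (rule prob_space_distr)
  show ?thesis
    using scaled_elog_le_iff[OF c_pos[OF assms], of _ 0] d.emeasure_le_1
    unfolding scaled_log_meas_def by (simp add: zero_ereal_def)
qed

lemma open_le_closed:
  assumes "i \<in> D"
  shows "scaled_log_meas \<mu> c (\<lambda>i. {x i<..<y i}) i \<le> scaled_log_meas \<mu> c (\<lambda>i. {x i..y i}) i"
  unfolding scaled_log_meas_def
  using assms by (intro scaled_elog_mono c_pos emeasure_mono) auto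

lemma Limsup_closed_le:
  assumes t: "0 \<le> t" "L t \<le> ereal P" and x: "eventually (\<lambda>i. ereal a \<le> x i) F"
  shows "Limsup F (scaled_log_meas \<mu> c (\<lambda>i. {x i..y i})) \<le> ereal (P - t * a)"
proof -
  have "Limsup F (scaled_log_meas \<mu> c (\<lambda>i. {x i..y i})) \<le> ereal (P - t * a) + ereal e" if e: "0 < e" for e
  proof -
    have "eventually (\<lambda>i. scaled_log_meas \<mu> c (\<lambda>i. {x i..y i}) i \<le> ereal (P - t * a + e)) F"
      using eventually_in_D eventually_scaled_lmgf_le[OF t(2) e] x
    proof eventually_elim
      case (elim i)
      have "emeasure (distr (\<mu> i) borel ereal) {x i..y i} = emeasure (\<mu> i) (ereal -` {x i..y i})"
        using elim by (intro emeasure_distr_ereal) auto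
      also have "\<dots> \<le> emeasure (\<mu> i) {a..}"
        using elim sets_\<mu> by (intro emeasure_mono) (auto dest: order_trans)
      also have "\<dots> \<le> ennreal (exp ((P + e - t * a) / c i))"
        using elim by (intro chernoff sets_\<mu> c_pos t) (simp_all add: scaled_lmgf_le_iff)
      finally show ?case
        unfolding scaled_log_meas_def using elim c_pos by (simp add: scaled_elog_le_iff algebra_simps)
    qed
    then show ?thesis by (simp add: Limsup_bounded)
  qed
  then show ?thesis by (rule ereal_le_epsilon2)
qed

lemma eventually_exp_small:
  assumes "0 < \<kappa>"
  shows "eventually (\<lambda>i. exp (- \<kappa> / c i) \<le> 1 / 4) F"
proof -
  have "0 < \<kappa> / ln (4::real)" using assms by simp
  then have "eventually (\<lambda>i. c i < \<kappa> / ln 4) F" using c_lim by (intro order_tendstoD)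
  with eventually_in_D show ?thesis
  proof eventually_elim
    case (elim i)
    then have "ln 4 \<le> \<kappa> / c i" using c_pos[of i] by (simp add: field_simps)
    then have "- \<kappa> / c i \<le> - ln 4" by simp
    then have "exp (- \<kappa> / c i) \<le> exp (- ln 4)" by (simp only: exp_le_cancel_iff)
    then show ?case by (simp add: exp_minus)
  qed
qed

text \<open>The conclusion is an implication that holds at all indices far enough out, so that it serves both the upper limit, where its
premise holds frequently, and the limit, where its premise holds eventually.\<close>

lemma open_interval_lower_bound:
  assumes t: "0 \<le> t" "t1 < t" "t < t2"
    and L: "L t1 = ereal p1" "L t = ereal p" "L t2 = ereal p2"
    and slopes: "a * (t - t1) < p - p1" "p2 - p < b * (t2 - t)"
    and x: "eventually (\<lambda>i. x i < ereal a) F" and y: "eventually (\<lambda>i. ereal b < y i) F"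
    and K: "K < p - t * b"
  obtains \<kappa> where "0 < \<kappa>"
    "eventually (\<lambda>i. ereal (p - \<kappa>) \<le> scaled_lmgf \<mu> c t i
       \<longrightarrow> ereal K \<le> scaled_log_meas \<mu> c (\<lambda>i. {x i<..<y i}) i) F"
proof -
  \<comment> \<open>Each gap between slopes has to absorb three errors \<open>\<kappa>\<close>: those of the moments at \<open>t\<close> and at
    \<open>t1\<close> or \<open>t2\<close>, and the exponential smallness of the tail. The target \<open>K\<close> has to absorb two.\<close>
  define \<kappa> where "\<kappa> = min ((p - t * b - K) / 2) (min ((p - p1 - a * (t - t1)) / 3) ((b * (t2 - t) - (p2 - p)) / 3))"
  have \<kappa>: "0 < \<kappa>" "2 * \<kappa> \<le> p - t * b - K" "3 * \<kappa> \<le> p - p1 - a * (t - t1)" "3 * \<kappa> \<le> b * (t2 - t) - (p2 - p)"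
    using K slopes unfolding \<kappa>_def by (auto simp: min_def)
  have L1: "L t1 \<le> ereal p1" and L2: "L t2 \<le> ereal p2" using L by auto
  have "eventually (\<lambda>i. ereal (p - \<kappa>) \<le> scaled_lmgf \<mu> c t i
       \<longrightarrow> ereal K \<le> scaled_log_meas \<mu> c (\<lambda>i. {x i<..<y i}) i) F"
    using eventually_in_D eventually_scaled_lmgf_le[OF L1 \<kappa>(1)] eventually_scaled_lmgf_le[OF L2 \<kappa>(1)]
      eventually_exp_small[OF \<kappa>(1)] x y
  proof eventually_elim
    case (elim i)
    show ?case
    proof
      assume "ereal (p - \<kappa>) \<le> scaled_lmgf \<mu> c t i"
      then have "ennreal (exp ((p - \<kappa> - t * b - \<kappa>) / c i)) \<le> emeasure (\<mu> i) {a<..<b}"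
        using elim t \<kappa>
        by (intro tilted_mass_bound[of _ _ t t1 t2 "p1 + \<kappa>" "p2 + \<kappa>"] prob_\<mu> sets_\<mu> c_pos)
          (simp_all add: scaled_lmgf_le_iff scaled_lmgf_ge_iff)
      also have "\<dots> \<le> emeasure (\<mu> i) (ereal -` {x i<..<y i})"
      proof (rule emeasure_mono)
        show "{a<..<b} \<subseteq> ereal -` {x i<..<y i}"
        proof
          fix z assume z: "z \<in> {a<..<b}"
          then have "ereal a < ereal z" "ereal z < ereal b" by auto
          with elim have "x i < ereal z" "ereal z < y i" by (blast intro: less_trans)+
          then show "z \<in> ereal -` {x i<..<y i}" by simp
        qed
        have "ereal -` {x i<..<y i} \<in> sets borel" by (rule measurable_sets_borel[of _ borel]) auto
        then show "ereal -` {x i<..<y i} \<in> sets (\<mu> i)" using elim sets_\<mu> by simp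
      qed
      also have "\<dots> = emeasure (distr (\<mu> i) borel ereal) {x i<..<y i}"
        using elim by (intro emeasure_distr_ereal[symmetric]) auto
      finally have "ereal (p - \<kappa> - t * b - \<kappa>) \<le> scaled_log_meas \<mu> c (\<lambda>i. {x i<..<y i}) i"
        unfolding scaled_log_meas_def using elim c_pos by (simp add: scaled_elog_ge_iff)
      moreover have "ereal K \<le> ereal (p - \<kappa> - t * b - \<kappa>)" using \<kappa> by simp
      ultimately show "ereal K \<le> scaled_log_meas \<mu> c (\<lambda>i. {x i<..<y i}) i" by (rule order_trans[rotated])
    qed
  qed
  with \<kappa>(1) show ?thesis by (rule that)
qed

end

locale tangent_interval_net = scaled_net D le \<mu> c + right_tangent L lam m V
  for D :: "'i set" and le \<mu> c lam m V +
  fixes x y :: "'i \<Rightarrow> ereal"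
  assumes x_lim: "(x \<longlongrightarrow> m) F" and y_Liminf: "m < Liminf F y"
begin

abbreviation "closed_net \<equiv> scaled_log_meas \<mu> c (\<lambda>i. {x i..y i})"
abbreviation "open_net \<equiv> scaled_log_meas \<mu> c (\<lambda>i. {x i<..<y i})"

lemma Limsup_closed_le_V: "Limsup F closed_net \<le> V"
proof (cases m)
  case (real r)
  have "Limsup F closed_net \<le> L t - ereal t * m" if t: "0 < t" for t
  proof (cases "L t")
    case (real p)
    have "Limsup F closed_net \<le> ereal (p - t * r) + ereal e" if e: "0 < e" for e
    proof -
      have "ereal (r - e / t) < m" using \<open>m = ereal r\<close> e t by simp
      then have "eventually (\<lambda>i. ereal (r - e / t) < x i) F" using x_lim by (intro order_tendstoD)
      then have "eventually (\<lambda>i. ereal (r - e / t) \<le> x i) F" by eventually_elim simp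
      then have "Limsup F closed_net \<le> ereal (p - t * (r - e / t))"
        using t real by (intro Limsup_closed_le) auto
      also have "p - t * (r - e / t) = p - t * r + e" using t by (simp add: algebra_simps)
      finally show ?thesis by simp
    qed
    then have "Limsup F closed_net \<le> ereal (p - t * r)" by (rule ereal_le_epsilon2)
    then show ?thesis using \<open>m = ereal r\<close> real by simp
  next
    case MInf
    obtain v where "V = ereal v" by (rule V_real)
    then show ?thesis using V_le[OF \<open>m = ereal r\<close>, of t] MInf by simp
  next
    case PInf
    then show ?thesis using \<open>m = ereal r\<close> by simp
  qed
  then show ?thesis unfolding V_eq_INF[OF real] by (intro INF_greatest) auto
next
  case MInf
  have "eventually (\<lambda>i. closed_net i \<le> 0) F"
    using eventually_in_D by eventually_elim (rule scaled_log_meas_le_0)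
  then show ?thesis using V_MInfty_case MInf by (simp add: Limsup_bounded)
qed (use m_less_PInfty in auto)

text \<open>Combines the choice of slopes with the tilting estimate. The whole interval \<open>]\<tau>,\<tau> + \<delta>[\<close> is provided
because the existence of limits will be known only at certain points accumulating at \<open>\<tau>\<close>.\<close>

lemma near_V_on_open:
  assumes v: "V = ereal v" and e: "0 < e"
  obtains \<tau> \<delta> where "affine_end L lam = ereal \<tau>" "0 < \<delta>"
    "\<And>t. \<tau> < t \<Longrightarrow> t < \<tau> + \<delta> \<Longrightarrow> \<exists>p \<kappa>. L t = ereal p \<and> 0 < \<kappa> \<and>
      eventually (\<lambda>i. ereal (p - \<kappa>) \<le> scaled_lmgf \<mu> c t i \<longrightarrow> ereal (v - e) \<le> open_net i) F"
proof -
  obtain b \<tau> \<delta> where *: "ereal b < Liminf F y" "affine_end L lam = ereal \<tau>" "lam \<le> \<tau>" "0 < \<delta>"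
    and win: "\<And>t. \<tau> < t \<Longrightarrow> t < \<tau> + \<delta> \<Longrightarrow> exposed_at b e t"
    by (rule exposed_slopes[OF y_Liminf e]) blast
  show ?thesis
  proof (rule that[OF *(2,4)])
    fix t assume t: "\<tau> < t" "t < \<tau> + \<delta>"
    then obtain t1 t2 p1 p p2 a where w: "t1 < t" "t < t2" "L t1 = ereal p1" "L t = ereal p" "L t2 = ereal p2"
      "m < ereal a" "a * (t - t1) < p - p1" "p2 - p < b * (t2 - t)" "V - ereal e < ereal (p - t * b)"
      using win unfolding exposed_at_def by blast
    have "0 \<le> t" using t *(3) lam_nonneg by simp
    moreover have "eventually (\<lambda>i. x i < ereal a) F" using x_lim w(6) by (rule order_tendstoD)
    moreover have "eventually (\<lambda>i. ereal b < y i) F" using *(1) by (rule less_LiminfD)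
    moreover have "v - e < p - t * b" using w(9) v by simp
    ultimately obtain \<kappa> where "0 < \<kappa>"
      "eventually (\<lambda>i. ereal (p - \<kappa>) \<le> scaled_lmgf \<mu> c t i \<longrightarrow> ereal (v - e) \<le> open_net i) F"
      using open_interval_lower_bound[of t t1 t2 p1 p p2 a b x y "v - e"] w by blast
    then show "\<exists>p \<kappa>. L t = ereal p \<and> 0 < \<kappa> \<and>
      eventually (\<lambda>i. ereal (p - \<kappa>) \<le> scaled_lmgf \<mu> c t i \<longrightarrow> ereal (v - e) \<le> open_net i) F"
      using w(4) by blast
  qed
qed

lemma V_le_Limsup_open: "V \<le> Limsup F open_net"
proof -
  obtain v where v: "V = ereal v" by (rule V_real)
  have "ereal v \<le> Limsup F open_net + ereal e" if e: "0 < e" for e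
  proof -
    obtain \<tau> \<delta> where "0 < \<delta>" and win: "\<And>t. \<tau> < t \<Longrightarrow> t < \<tau> + \<delta> \<Longrightarrow> \<exists>p \<kappa>. L t = ereal p \<and> 0 < \<kappa> \<and>
      eventually (\<lambda>i. ereal (p - \<kappa>) \<le> scaled_lmgf \<mu> c t i \<longrightarrow> ereal (v - e) \<le> open_net i) F"
      by (rule near_V_on_open[OF v e]) blast
    then obtain p \<kappa> where p: "L (\<tau> + \<delta> / 2) = ereal p" "0 < \<kappa>"
      and imp: "eventually (\<lambda>i. ereal (p - \<kappa>) \<le> scaled_lmgf \<mu> c (\<tau> + \<delta> / 2) i \<longrightarrow> ereal (v - e) \<le> open_net i) F"
      using win[of "\<tau> + \<delta> / 2"] \<open>0 < \<delta>\<close> by fastforce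
    have "ereal (v - e) \<le> Limsup F open_net"
    proof (rule ccontr)
      assume "\<not> ereal (v - e) \<le> Limsup F open_net"
      then have "eventually (\<lambda>i. open_net i < ereal (v - e)) F" by (intro Limsup_lessD) simp
      with imp have "eventually (\<lambda>i. scaled_lmgf \<mu> c (\<tau> + \<delta> / 2) i \<le> ereal (p - \<kappa>)) F"
        by eventually_elim auto
      then have "L (\<tau> + \<delta> / 2) \<le> ereal (p - \<kappa>)" unfolding Lbar_def by (rule Limsup_bounded)
      then show False using p by simp
    qed
    then show ?thesis by (cases "Limsup F open_net") auto
  qed
  then show ?thesis unfolding v by (rule ereal_le_epsilon2)
qed

lemma Limsup_open_le_closed: "Limsup F open_net \<le> Limsup F closed_net"
  using eventually_in_D by (intro Limsup_mono) (auto elim!: eventually_mono intro: open_le_closed)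

lemma Limsup_eq_V: "Limsup F closed_net = V" "Limsup F open_net = V"
  using Limsup_closed_le_V V_le_Limsup_open Limsup_open_le_closed by (auto intro: antisym order_trans)

text \<open>Some \<open>s k\<close> lies in the interval to the right of \<open>\<tau>\<close> on which tilting is available; at such a point
the scaled log-moments are eventually close to their limit, so the lower bound holds eventually.\<close>

lemma nets_tendsto_V:
  fixes s :: "nat \<Rightarrow> real"
  assumes s: "\<And>k. ereal (s k) > affine_end L lam" "(\<lambda>k. ereal (s k)) \<longlonglongrightarrow> affine_end L lam"
    and ex: "\<And>k. L_exists F \<mu> c (s k)"
  shows "(closed_net \<longlongrightarrow> V) F" "(open_net \<longlongrightarrow> V) F"
proof -
  obtain v where v: "V = ereal v" by (rule V_real)
  have low: "eventually (\<lambda>i. ereal (v - e) \<le> open_net i) F" if e: "0 < e" for e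
  proof -
    obtain \<tau> \<delta> where \<tau>: "affine_end L lam = ereal \<tau>" "0 < \<delta>"
      and win: "\<And>t. \<tau> < t \<Longrightarrow> t < \<tau> + \<delta> \<Longrightarrow> \<exists>p \<kappa>. L t = ereal p \<and> 0 < \<kappa> \<and>
        eventually (\<lambda>i. ereal (p - \<kappa>) \<le> scaled_lmgf \<mu> c t i \<longrightarrow> ereal (v - e) \<le> open_net i) F"
      by (rule near_V_on_open[OF v e]) blast
    have "eventually (\<lambda>k. ereal (s k) < ereal (\<tau> + \<delta>)) sequentially"
      using s(2) \<tau> by (intro order_tendstoD) auto
    then obtain k where "s k < \<tau> + \<delta>" using eventually_happens[of _ sequentially] by auto
    moreover have "\<tau> < s k" using s(1)[of k] \<tau> by simp
    ultimately obtain p \<kappa> where p: "L (s k) = ereal p" "0 < \<kappa>"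
      and imp: "eventually (\<lambda>i. ereal (p - \<kappa>) \<le> scaled_lmgf \<mu> c (s k) i \<longrightarrow> ereal (v - e) \<le> open_net i) F"
      using win by blast
    have "eventually (\<lambda>i. ereal (p - \<kappa>) < scaled_lmgf \<mu> c (s k) i) F"
      using ex[of k] p unfolding L_exists_def by (intro order_tendstoD) auto
    with imp show ?thesis by eventually_elim auto
  qed
  have squeeze: "(g \<longlongrightarrow> V) F" if ge: "\<And>i. i \<in> D \<Longrightarrow> open_net i \<le> g i" and le: "Limsup F g \<le> V" for g
  proof (rule order_tendstoI)
    fix l assume "l < V"
    then obtain z where z: "l < ereal z" "z < v" using v ereal_dense2[of l V] by auto
    have "eventually (\<lambda>i. ereal z \<le> open_net i) F" using low[of "v - z"] z(2) by simp
    with eventually_in_D show "eventually (\<lambda>i. l < g i) F"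
    proof eventually_elim
      case (elim i)
      have "l < open_net i" using z(1) elim(2) by (rule less_le_trans)
      also have "\<dots> \<le> g i" using elim(1) by (rule ge)
      finally show ?case .
    qed
  next
    fix u assume "V < u"
    then show "eventually (\<lambda>i. g i < u) F" using le by (intro Limsup_lessD) simp
  qed
  show "(closed_net \<longlongrightarrow> V) F" using open_le_closed Limsup_eq_V by (intro squeeze) auto
  show "(open_net \<longlongrightarrow> V) F" using Limsup_eq_V by (intro squeeze) auto
qed

lemma legendre_tendsto:
  assumes m: "m = -\<infinity>"
  shows "((\<lambda>i. - legendre L (x i)) \<longlongrightarrow> 0) F"
proof (rule order_tendstoI)
  fix l :: ereal assume "l < 0"
  then obtain z where z: "l < ereal z" "ereal z < 0" using ereal_dense2 by blast
  define e where "e = - z"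
  have e: "l < ereal (- e)" "0 < e" using z by (auto simp: e_def zero_ereal_def)
  obtain B where B: "\<And>\<xi>. \<xi> < ereal B \<Longrightarrow> legendre L \<xi> \<le> ereal e"
    by (rule legendre_small[OF m e(2)]) blast
  have "eventually (\<lambda>i. x i < ereal B) F" using x_lim m by (intro order_tendstoD) auto
  then show "eventually (\<lambda>i. l < - legendre L (x i)) F"
  proof eventually_elim
    case (elim i)
    have "ereal (- e) \<le> - legendre L (x i)" using B[OF elim] by (cases "legendre L (x i)") auto
    with e(1) show ?case by (rule less_le_trans)
  qed
next
  fix u :: ereal assume u: "0 < u"
  have "- legendre L (x i) < u" for i
  proof (rule le_less_trans[OF _ u])
    show "- legendre L (x i) \<le> 0" using legendre_nonneg[OF m, of "x i"] by simp
  qed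
  then show "eventually (\<lambda>i. - legendre L (x i) < u) F" by simp
qed

end

theorem theorem1:
  fixes D :: "'i set" and le :: "'i \<Rightarrow> 'i \<Rightarrow> bool"
    and \<mu> :: "'i \<Rightarrow> real measure" and c :: "'i \<Rightarrow> real"
    and lam :: real and x y :: "'i \<Rightarrow> ereal"
  defines "F \<equiv> tails D le"
  defines "L \<equiv> Lbar F \<mu> c"
  defines "Lr \<equiv> right_lim (right_deriv L) lam"
  defines "V \<equiv> right_lim L lam - ereal lam * Lr"
  defines "closed_net \<equiv> scaled_log_meas \<mu> c (\<lambda>i. {x i..y i})"
  defines "open_net \<equiv> scaled_log_meas \<mu> c (\<lambda>i. {x i<..<y i})"
  assumes "directed_set D le"
    and "\<And>i. i \<in> D \<Longrightarrow> real_distribution (\<mu> i)"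
    and "\<And>i. i \<in> D \<Longrightarrow> c i > 0"
    and "(c \<longlongrightarrow> 0) F"
    and "lam \<ge> 0"
    and "Lr > -\<infinity> \<Longrightarrow> Lr islimpt {right_deriv L t |t. t > lam}"
    and "Lr = -\<infinity> \<Longrightarrow> lam = 0 \<and> L lam = right_lim L lam"
    and "(x \<longlongrightarrow> Lr) F"
    and "Liminf F y > Lr"
  shows "Limsup F closed_net = V \<and> Limsup F open_net = V
    \<and> (Lr \<noteq> -\<infinity> \<longrightarrow>
          V = - legendre L Lr \<and> V = (INF t\<in>{0<..}. L t - ereal t * Lr))
    \<and> (Lr = -\<infinity> \<longrightarrow>
          V = 0 \<and> ((\<lambda>i. - legendre L (x i)) \<longlongrightarrow> 0) F)
    \<and> ((\<exists>s :: nat \<Rightarrow> real.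
            (\<forall>k. ereal (s k) > affine_end L lam)
          \<and> (\<lambda>k. ereal (s k)) \<longlonglongrightarrow> affine_end L lam
          \<and> (\<forall>k. L_exists F \<mu> c (s k)))
        \<longrightarrow> (closed_net \<longlongrightarrow> Limsup F closed_net) F
          \<and> (open_net \<longlongrightarrow> Limsup F open_net) F)"
proof -
  interpret N: scaled_net D le \<mu> c
    by (rule scaled_net.intro) (fact assms(7-10)[unfolded F_def])+
  interpret tangent_interval_net D le \<mu> c lam Lr V x y
  proof (intro tangent_interval_net.intro right_tangent.intro)
    show "scaled_net D le \<mu> c" "convex_from_zero N.L" by unfold_locales
    show "right_tangent_axioms N.L lam Lr V"
      unfolding F_def[symmetric] L_def[symmetric]
      by (rule right_tangent_axioms.intro[OF assms(11) meta_eq_to_obj_eq[OF Lr_def]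
            meta_eq_to_obj_eq[OF V_def] assms(12,13)])
    show "tangent_interval_net_axioms D le Lr x y"
      by (rule tangent_interval_net_axioms.intro) (fact assms(14,15)[unfolded F_def])+
  qed
  note folds = F_def[symmetric] L_def[symmetric] closed_net_def[symmetric] open_net_def[symmetric]
  note lims = Limsup_eq_V[folded F_def closed_net_def open_net_def]
  have real: "V = - legendre L Lr \<and> V = (INF t\<in>{0<..}. L t - ereal t * Lr)" if fin: "Lr \<noteq> -\<infinity>"
  proof -
    obtain r where "Lr = ereal r" using fin m_less_PInfty by (cases Lr) auto
    from V_eq_legendre[OF this] V_eq_INF[OF this] show ?thesis unfolding folds by (rule conjI)
  qed
  have limits: "(closed_net \<longlongrightarrow> V) F \<and> (open_net \<longlongrightarrow> V) F"
    if ex: "\<exists>s :: nat \<Rightarrow> real. (\<forall>k. ereal (s k) > affine_end L lam)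
      \<and> (\<lambda>k. ereal (s k)) \<longlonglongrightarrow> affine_end L lam \<and> (\<forall>k. L_exists F \<mu> c (s k))"
  proof -
    from ex obtain s :: "nat \<Rightarrow> real" where s: "\<forall>k. ereal (s k) > affine_end L lam"
      "(\<lambda>k. ereal (s k)) \<longlonglongrightarrow> affine_end L lam" "\<forall>k. L_exists F \<mu> c (s k)"
      by (elim exE conjE)
    from nets_tendsto_V[unfolded folds, OF s(1)[rule_format] s(2) s(3)[rule_format]]
    show ?thesis by (rule conjI)
  qed
  show ?thesis
    unfolding lims
    by (intro conjI impI refl V_MInfty_case legendre_tendsto[unfolded folds]
        real[THEN conjunct1] real[THEN conjunct2] limits[THEN conjunct1] limits[THEN conjunct2])
qed

end
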